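(* Let $Z_1, Z_2, \ldots$ be independent, identically distributed random vectors in $\mathbb{R}^2$ with $\mathbb{E}[\|Z_1\|^2] < \infty$ and $\|\mathbb{E}[Z_1]\| \neq 0$. Let $S_0 := 0$ and $S_n := \sum_{i=1}^n Z_i$ for $n \geq 1$, and let $L_n$ denote the length of the perimeter of the convex hull of $\{S_0, S_1, \ldots, S_n\}$. Then \[ \lim_{n \to \infty} n^{-1} \operatorname{Var}[L_n] = \frac{4\, \mathbb{E}\big[ \big( (Z_1 - \mathbb{E}[Z_1]) \cdot \mathbb{E}[Z_1] \big)^2 \big]}{\|\mathbb{E}[Z_1]\|^2} =: \sigma^2 \in [0,\infty). \]
   Context: $\cdot$ denotes the Euclidean inner product and $\|\cdot\|$ the Euclidean norm on $\mathbb{R}^2$. *)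

theory Defs
  imports "HOL-Analysis.Analysis" "HOL-Probability.Probability"
begin

text \<open>Perimeter length of a compact convex set K in the plane that is a polygon
  (convex hull of finitely many points).  If K is two-dimensional, its boundary is
  the union of its edges (faces of affine dimension 1) and the perimeter is the sum of
  the edge lengths.  If K is degenerate (a segment, a point, or empty), the boundary
  curve traverses the segment twice, so the perimeter is twice its length.\<close>

definition polygon_perimeter :: "(real^2) set \<Rightarrow> real" where
  "polygon_perimeter K =
     (if aff_dim K \<le> 1 then 2 * diameter K
      else (\<Sum>F\<in>{F. F face_of K \<and> aff_dim F = 1}. diameter F))"

definition walk :: "(nat \<Rightarrow> 'a \<Rightarrow> real^2) \<Rightarrow> nat \<Rightarrow> 'a \<Rightarrow> real^2" where
  "walk Z n \<omega> = (\<Sum>i\<in>{1..n}. Z i \<omega>)"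

definition hull_perimeter_walk :: "(nat \<Rightarrow> 'a \<Rightarrow> real^2) \<Rightarrow> nat \<Rightarrow> 'a \<Rightarrow> real" where
  "hull_perimeter_walk Z n \<omega> =
     polygon_perimeter (convex hull ((\<lambda>k. walk Z k \<omega>) ` {0..n}))"

end

theory Submission
  imports Defs
begin

text \<open>Write e for a unit vector.  By Cauchy's formula the perimeter of the hull is the integral, over a
  half circle of directions e, of the width of the walk in direction e.  Take the half circle of
  directions making an acute angle with the drift.  There the width equals the projection of S_n on e
  plus two terms: the largest amount by which the projected walk stays above its final value, and the
  largest amount by which it falls below its start.  The projections of S_n integrate to twice the
  component of S_n along the drift, a sum of i.i.d. variables whose variance gives the limit.  Each of
  the two other terms is distributed as the maximum of a walk with negative drift, whose second moment
  is o(n); hence their integral has variance o(n) and does not contribute.\<close>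

subsection \<open>Cauchy's perimeter formula for polygons\<close>

text \<open>The perimeter is defined through the edges of a hull whose combinatorics is random, so
  neither its moments nor its measurability are directly accessible; the integral over directions
  reduces both to one-dimensional walks. The unit vectors of the half circle centred at the drift
  integrate to twice the drift direction, and this 2, squared, is the 4 in the limit. For the
  maximum of a walk with negative drift, a bounded second moment in general needs a third moment of
  the steps. With two moments only o(n) can be expected, and truncation supplies it. At the two ends
  of the half circle the projected drift vanishes and only an O(n) bound remains. The estimate is
  thus not uniform in the direction, and dominated convergence over directions takes the place of
  uniformity, with the O(n) bound as dominating function. The remainder and the projection of S_n
  are dependent, but a covariance is at most the geometric mean of the two variances, here o(n) and
  O(n), so a second moment estimate of the remainder is enough.\<close>

text \<open>A frontier point beyond the exit point would place the exit point strictly between an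
  interior point and a point of the closure, hence in the interior.\<close>

lemma frontier_on_ray:
  fixes K :: "'a::euclidean_space set"
  assumes "convex K" "bounded K" "p \<in> interior K" "u \<noteq> 0"
  obtains d where "d > 0" "\<And>s. s \<ge> 0 \<Longrightarrow> p + s *\<^sub>R u \<in> frontier K \<longleftrightarrow> s = d"
proof -
  obtain d where d: "0 < d" "p + d *\<^sub>R u \<in> frontier K"
    and inside: "\<And>s. \<lbrakk>0 \<le> s; s < d\<rbrakk> \<Longrightarrow> p + s *\<^sub>R u \<in> interior K"
    using ray_to_frontier[OF assms(2-4)] by blast
  have "s = d" if s: "s \<ge> 0" "p + s *\<^sub>R u \<in> frontier K" for s
  proof (rule ccontr)
    assume "s \<noteq> d"
    then consider "s < d" | "s > d" by linarith
    then show False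
    proof cases
      case 1
      then show False using inside[OF s(1)] s(2) by (simp add: frontier_def)
    next
      case 2
      have "p + d *\<^sub>R u \<in> open_segment p (p + s *\<^sub>R u)"
        unfolding in_segment using 2 d(1) assms(4)
        by (auto intro!: exI[of _ "d / s"] simp: algebra_simps)
      then have "p + d *\<^sub>R u \<in> interior K"
        using in_interior_closure_convex_segment[OF assms(1,3)] s(2)
        by (auto simp: frontier_def)
      then show False using d(2) by (simp add: frontier_def)
    qed
  qed
  then show thesis using d that by blast
qed

text \<open>The rays along \<open>u\<close> and \<open>- u\<close> leave \<open>K\<close> once each.
  That \<open>p\<close> lies strictly between the exit points serves later to show that no single
  edge carries both.\<close>

lemma frontier_on_line:
  fixes K :: "'a::euclidean_space set"
  assumes "convex K" "bounded K" "p \<in> interior K" "u \<noteq> 0"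
  obtains q r where "q \<in> frontier K" "r \<in> frontier K" "p \<in> open_segment q r"
    "\<And>s. p + s *\<^sub>R u \<in> frontier K \<longleftrightarrow> p + s *\<^sub>R u \<in> {q, r}"
    "q \<in> range (\<lambda>s. p + s *\<^sub>R u)" "r \<in> range (\<lambda>s. p + s *\<^sub>R u)"
proof -
  obtain d where d: "d > 0" "\<And>s. s \<ge> 0 \<Longrightarrow> p + s *\<^sub>R u \<in> frontier K \<longleftrightarrow> s = d"
    using frontier_on_ray[OF assms] by blast
  obtain c where c: "c > 0" "\<And>s. s \<ge> 0 \<Longrightarrow> p + s *\<^sub>R (- u) \<in> frontier K \<longleftrightarrow> s = c"
    using frontier_on_ray[OF assms(1-3), of "- u"] assms(4) by auto
  have iff: "p + s *\<^sub>R u \<in> frontier K \<longleftrightarrow> s = d \<or> s = - c" for s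
    using d(2)[of s] c(2)[of "- s"] d(1) c(1) by (cases "s \<ge> 0") auto
  show thesis
  proof (rule that[of "p + d *\<^sub>R u" "p + (- c) *\<^sub>R u"])
    show "p \<in> open_segment (p + d *\<^sub>R u) (p + (- c) *\<^sub>R u)"
      unfolding in_segment
    \<comment> \<open>The weight at which the displacements \<open>d\<close> and \<open>- c\<close>
      along \<open>u\<close> cancel.\<close>
    proof (intro conjI exI[of _ "d / (d + c)"])
      have "d + c \<noteq> 0" using d(1) c(1) by linarith
      then show "p + d *\<^sub>R u \<noteq> p + (- c) *\<^sub>R u" using assms(4)
        by (metis add_left_cancel scaleR_right_imp_eq add.inverse_inverse eq_neg_iff_add_eq_0)
      have "(1 - d / (d + c)) *\<^sub>R (p + d *\<^sub>R u) + (d / (d + c)) *\<^sub>R (p + (- c) *\<^sub>R u)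
          = p + ((1 - d / (d + c)) * d - d / (d + c) * c) *\<^sub>R u"
        by (simp add: algebra_simps)
      also have "(1 - d / (d + c)) * d - d / (d + c) * c = 0"
        using d(1) c(1) by (simp add: divide_simps)
      finally show "p = (1 - d / (d + c)) *\<^sub>R (p + d *\<^sub>R u) + (d / (d + c)) *\<^sub>R (p + (- c) *\<^sub>R u)"
        by simp
    qed (use d(1) c(1) in \<open>auto simp: divide_simps\<close>)
    show "p + s *\<^sub>R u \<in> frontier K \<longleftrightarrow> p + s *\<^sub>R u \<in> {p + d *\<^sub>R u, p + (- c) *\<^sub>R u}" for s
    proof -
      have "p + s *\<^sub>R u \<in> {p + d *\<^sub>R u, p + (- c) *\<^sub>R u} \<longleftrightarrow> s = d \<or> s = - c"
        unfolding insert_iff add_left_cancel scaleR_cancel_right using assms(4) by blast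
      then show ?thesis using iff by blast
    qed
  qed (auto simp: iff simp del: scaleR_minus_left)
qed

text \<open>If the interior misses the level, convexity puts it on one side, and passing to the
  closure puts \<open>K\<close> there too. The level then cuts out a nonempty face of
  \<open>K\<close>; an extreme point of this face is one of \<open>K\<close>, and its level is
  excluded.\<close>

lemma interior_meets_level:
  fixes K :: "'a::euclidean_space set"
  assumes K: "convex K" "compact K" "interior K \<noteq> {}"
    and t: "t \<in> (\<bullet>) e ` K" "t \<notin> (\<bullet>) e ` {x. x extreme_point_of K}"
  obtains p where "p \<in> interior K" "e \<bullet> p = t"
proof -
  have "\<exists>p\<in>interior K. e \<bullet> p = t"
  proof (rule ccontr)
    assume none: "\<not> (\<exists>p\<in>interior K. e \<bullet> p = t)"
    have conv: "convex ((\<bullet>) e ` interior K)"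
      by (intro convex_linear_image convex_interior K bounded_linear.linear bounded_linear_inner_right)
    have face: False if side: "(\<forall>p\<in>interior K. e \<bullet> p \<le> t) \<or> (\<forall>p\<in>interior K. t \<le> e \<bullet> p)"
    proof -
      have cl: "closure (interior K) = K"
        using K by (simp add: convex_closure_interior compact_imp_closed)
      have "(\<forall>p\<in>K. e \<bullet> p \<le> t) \<or> (\<forall>p\<in>K. t \<le> e \<bullet> p)"
      proof -
        have "K \<subseteq> {p. e \<bullet> p \<le> t}" if "\<forall>p\<in>interior K. e \<bullet> p \<le> t"
          by (subst cl[symmetric], rule closure_minimal) (use that in \<open>auto intro: closed_halfspace_le\<close>)
        moreover have "K \<subseteq> {p. t \<le> e \<bullet> p}" if "\<forall>p\<in>interior K. t \<le> e \<bullet> p"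
          by (subst cl[symmetric], rule closure_minimal) (use that in \<open>auto intro: closed_halfspace_ge\<close>)
        ultimately show ?thesis using side by auto
      qed
      then have f: "(K \<inter> {x. e \<bullet> x = t}) face_of K"
        by (elim disjE; intro face_of_Int_supporting_hyperplane_le face_of_Int_supporting_hyperplane_ge K(1); blast)
      have "K \<inter> {x. e \<bullet> x = t} \<noteq> {}" using t(1) by auto
      moreover have "compact (K \<inter> {x. e \<bullet> x = t})" "convex (K \<inter> {x. e \<bullet> x = t})"
        using K by (auto intro: compact_Int_closed closed_hyperplane convex_Int convex_hyperplane)
      ultimately obtain x where "x extreme_point_of (K \<inter> {x. e \<bullet> x = t})"
        using extreme_point_exists_convex by blast
      then show False using extreme_point_of_face[OF f] t(2) by auto
    qed
    show False
    proof (rule face, rule ccontr)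
      assume "\<not> ((\<forall>p\<in>interior K. e \<bullet> p \<le> t) \<or> (\<forall>p\<in>interior K. t \<le> e \<bullet> p))"
      then obtain p q where pq: "p \<in> interior K" "q \<in> interior K" "e \<bullet> p > t" "e \<bullet> q < t"
        by (auto simp: not_le)
      then have "closed_segment (e \<bullet> q) (e \<bullet> p) \<subseteq> (\<bullet>) e ` interior K"
        using conv by (intro closed_segment_subset imageI)
      then have "t \<in> (\<bullet>) e ` interior K"
        using pq(3,4) by (auto simp: closed_segment_eq_real_ivl)
      then show False using none by auto
    qed
  qed
  then show thesis using that by blast
qed

text \<open>The line at level \<open>t\<close> crosses the frontier at two points \<open>q\<close>
  and \<open>r\<close> on opposite sides of an interior point. Each lies on some edge, and on only
  one because the line avoids the vertices.\<close>

lemma card_edges_on_level: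
  fixes K :: "(real^2) set"
  assumes poly: "polytope K" and dim: "aff_dim K = 2" and e: "e \<noteq> 0"
    and t: "t \<in> (\<bullet>) e ` K" "t \<notin> (\<bullet>) e ` {x. x extreme_point_of K}"
  shows "card {F. F face_of K \<and> aff_dim F = 1 \<and> t \<in> (\<bullet>) e ` F} = 2"
proof -
  have K: "convex K" "compact K" "bounded K"
    using poly polytope_imp_convex polytope_imp_compact polytope_imp_bounded by auto
  have intK: "interior K \<noteq> {}" and rel: "rel_frontier K = frontier K"
    using dim by (auto simp: interior_rel_interior_gen[of K] rel_interior_eq_empty K(1)
        rel_frontier_def frontier_def)
  have edge: "F face_of K \<and> aff_dim F = 1 \<longleftrightarrow> F facet_of K" for F
    using dim by (auto simp: facet_of_def)
  have front: "frontier K = \<Union>{F. F facet_of K}"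
    using rel_frontier_of_polyhedron[OF polytope_imp_polyhedron[OF poly]] rel by simp
  obtain p where p: "p \<in> interior K" "e \<bullet> p = t"
    using interior_meets_level[OF K(1,2) intK t] by blast
  \<comment> \<open>\<open>e\<close> turned by a right angle, so that the level line is
    \<open>p\<close> plus the multiples of \<open>u\<close>.\<close>
  define u :: "real^2" where "u = vector [- (e $ 2), e $ 1]"
  have u: "u \<noteq> 0" "e \<bullet> u = 0"
    using e by (auto simp: u_def vec_eq_iff inner_vec_def forall_2 sum_2 vector_2)
  have line: "\<exists>s. x = p + s *\<^sub>R u" if "e \<bullet> x = t" for x
  proof -
    define w where "w = x - p"
    have w: "e $ 1 * w $ 1 + e $ 2 * w $ 2 = 0"
      using that p(2) by (simp add: w_def inner_vec_def sum_2 algebra_simps)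
    have ne: "(e $ 1)\<^sup>2 + (e $ 2)\<^sup>2 \<noteq> 0"
      using e by (simp add: sum_power2_eq_zero_iff vec_eq_iff forall_2)
    \<comment> \<open>The coordinate of \<open>w\<close> along \<open>u\<close>, that is, the inner
      product of \<open>u\<close> and \<open>w\<close> divided by the squared norm of
      \<open>u\<close>.\<close>
    define s where "s = (e $ 1 * w $ 2 - e $ 2 * w $ 1) / ((e $ 1)\<^sup>2 + (e $ 2)\<^sup>2)"
    have "((e $ 1)\<^sup>2 + (e $ 2)\<^sup>2) * w $ 1 = - (e $ 1 * w $ 2 - e $ 2 * w $ 1) * e $ 2"
      "((e $ 1)\<^sup>2 + (e $ 2)\<^sup>2) * w $ 2 = (e $ 1 * w $ 2 - e $ 2 * w $ 1) * e $ 1"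
      using w by algebra+
    then have "w $ 1 = s * (- (e $ 2))" "w $ 2 = s * e $ 1"
      using ne by (auto simp: s_def field_simps)
    then have "x = p + s *\<^sub>R u"
      by (simp add: w_def u_def vec_eq_iff forall_2 vector_2 algebra_simps)
    then show ?thesis ..
  qed
  obtain q r where qr: "q \<in> frontier K" "r \<in> frontier K" "p \<in> open_segment q r"
    and fr: "\<And>s. p + s *\<^sub>R u \<in> frontier K \<longleftrightarrow> p + s *\<^sub>R u \<in> {q, r}"
    and range: "q \<in> range (\<lambda>s. p + s *\<^sub>R u)" "r \<in> range (\<lambda>s. p + s *\<^sub>R u)"
    using frontier_on_line[OF K(1,3) p(1) u(1)] by blast
  have level: "e \<bullet> q = t" "e \<bullet> r = t"
    using range p(2) u(2) by (auto simp: inner_add_right)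
  have fr': "x \<in> {q, r}" if "x \<in> frontier K" "e \<bullet> x = t" for x
    using line[OF that(2)] fr that(1) by auto
  have unique: "F = G" if FG: "F facet_of K" "G facet_of K" "x \<in> F" "x \<in> G" "e \<bullet> x = t" for F G x
  proof (rule ccontr)
    assume "F \<noteq> G"
    have *: "F face_of K" "G face_of K" "aff_dim F = 1" "aff_dim G = 1"
      using FG(1,2) edge by auto
    \<comment> \<open>Distinct edges meet in a proper face of at least one of them, so in dimension
      below 1. Since it contains \<open>x\<close>, this face is the vertex \<open>x\<close>, whose
      level is excluded.\<close>
    have I: "(F \<inter> G) face_of K" using * face_of_Int by blast
    have "(F \<inter> G) face_of F" "(F \<inter> G) face_of G"
      using I * by (meson face_of_imp_subset face_of_subset inf_le1 inf_le2)+
    moreover have "F \<inter> G \<noteq> F \<or> F \<inter> G \<noteq> G" using \<open>F \<noteq> G\<close> by auto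
    moreover have "convex F" "convex G" using * face_of_imp_convex by auto
    ultimately have "aff_dim (F \<inter> G) < 1"
      using face_of_aff_dim_lt *(3,4) by metis
    moreover have "aff_dim (F \<inter> G) \<ge> 0"
      using FG aff_dim_geq[of "F \<inter> G"] aff_dim_empty[of "F \<inter> G"] by (cases "aff_dim (F \<inter> G) = -1") auto
    ultimately have "aff_dim (F \<inter> G) = 0" by linarith
    then obtain y where "F \<inter> G = {y}" using aff_dim_eq_0 by blast
    then have "{x} face_of K" using I FG by (metis IntI singletonD)
    then show False using face_of_singleton t(2) FG(5) by blast
  qed
  obtain F G where F: "F facet_of K" "q \<in> F" and G: "G facet_of K" "r \<in> G"
    using qr(1,2) front by auto
  \<comment> \<open>A common edge would contain, by convexity, the interior point \<open>p\<close>
    between \<open>q\<close> and \<open>r\<close>.\<close>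
  have "F \<noteq> G"
  proof
    assume "F = G"
    then have "p \<in> F"
      using F G qr(3) face_of_imp_convex facet_of_imp_face_of
      by (metis convex_contains_open_segment subsetD)
    then show False using F(1) front p(1) by (auto simp: frontier_def)
  qed
  have only: "H \<in> {F, G}" if "H facet_of K" "t \<in> (\<bullet>) e ` H" for H
  proof -
    obtain x where x: "x \<in> H" "e \<bullet> x = t" using \<open>t \<in> (\<bullet>) e ` H\<close> by auto
    then have "x \<in> {q, r}" using front that(1) fr' by blast
    then show ?thesis using unique F G that(1) x by blast
  qed
  then have "{F. F face_of K \<and> aff_dim F = 1 \<and> t \<in> (\<bullet>) e ` F} = {F, G}"
  proof (intro equalityI subsetI)
    fix H assume "H \<in> {F. F face_of K \<and> aff_dim F = 1 \<and> t \<in> (\<bullet>) e ` F}"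
    then show "H \<in> {F, G}" using edge only by blast
  next
    fix H assume "H \<in> {F, G}"
    then have "H facet_of K" "q \<in> H \<or> r \<in> H" using F G by auto
    moreover from this(2) have "t \<in> (\<bullet>) e ` H" using level by (metis imageI)
    ultimately show "H \<in> {F. F face_of K \<and> aff_dim F = 1 \<and> t \<in> (\<bullet>) e ` F}"
      using edge by blast
  qed
  then show ?thesis using \<open>F \<noteq> G\<close> by simp
qed

section \<open>Unit directions and integrals over a half circle\<close>

definition dir :: "real \<Rightarrow> real^2" where
  "dir \<theta> = vector [cos \<theta>, sin \<theta>]"

lemma inner_dir: "dir \<theta> \<bullet> x = cos \<theta> * x $ 1 + sin \<theta> * x $ 2"
  by (simp add: dir_def inner_vec_def sum_2 vector_2)

lemma inner_dir_dir: "dir \<theta> \<bullet> dir \<phi> = cos (\<theta> - \<phi>)"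
  unfolding inner_dir by (simp add: cos_diff dir_def vector_2)

lemma norm_dir [simp]: "norm (dir \<theta>) = 1"
  unfolding norm_eq_1 inner_dir_dir by simp

lemma dir_nonzero [simp]: "dir \<theta> \<noteq> 0"
  using norm_dir[of \<theta>] by (intro notI) (simp del: norm_dir)

lemma polar_form:
  fixes v :: "real^2"
  obtains \<phi> where "v = norm v *\<^sub>R dir \<phi>"
proof (cases "v = 0")
  case False
  have n: "(norm v)\<^sup>2 = (v $ 1)\<^sup>2 + (v $ 2)\<^sup>2"
    by (simp only: power2_norm_eq_inner) (simp add: inner_vec_def sum_2 power2_eq_square)
  have "(v $ 1 / norm v)\<^sup>2 + (v $ 2 / norm v)\<^sup>2 = 1"
    using False by (simp add: power_divide add_divide_distrib[symmetric] n[symmetric])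
  then obtain \<phi> where \<phi>: "v $ 1 / norm v = cos \<phi>" "v $ 2 / norm v = sin \<phi>"
    using sincos_total_2pi by metis
  have "v = norm v *\<^sub>R dir \<phi>"
    unfolding dir_def \<phi>[symmetric] using False by (simp add: vec_eq_iff forall_2 vector_2)
  then show thesis by (rule that)
next
  case True
  then have "v = norm v *\<^sub>R dir 0" by simp
  then show thesis by (rule that)
qed

text \<open>Angles are reduced modulo pi, not 2 pi: only absolute values of inner products are to be
  integrated, so the sign \<open>c\<close> is harmless and the window can have length pi.\<close>

lemma dir_shift:
  obtains \<psi> c where "\<psi> \<in> {a - pi / 2..a + pi / 2}" "dir \<phi> = c *\<^sub>R dir \<psi>" "\<bar>c\<bar> = 1"
proof -
  \<comment> \<open>The number of half turns that separate \<open>\<phi>\<close> from the window of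
    length pi centred at \<open>a\<close>.\<close>
  define k where "k = \<lfloor>(\<phi> - a + pi / 2) / pi\<rfloor>"
  define \<psi> where "\<psi> = \<phi> - of_int k * pi"
  have "of_int k \<le> (\<phi> - a + pi / 2) / pi" "(\<phi> - a + pi / 2) / pi < of_int k + 1"
    by (auto simp: k_def)
  then have "\<psi> \<in> {a - pi / 2..a + pi / 2}"
    by (simp add: \<psi>_def field_simps)
  moreover have "sin (of_int k * pi) = 0"
    using sin_npi_int[of k] by (simp only: mult.commute)
  then have "dir \<phi> = cos (of_int k * pi) *\<^sub>R dir \<psi>" "\<bar>cos (of_int k * pi)\<bar> = 1"
  proof -
    assume s: "sin (of_int k * pi) = 0"
    have "\<phi> = \<psi> + of_int k * pi" by (simp add: \<psi>_def)
    then show "dir \<phi> = cos (of_int k * pi) *\<^sub>R dir \<psi>"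
      using s by (simp add: dir_def vec_eq_iff forall_2 vector_2 cos_add sin_add)
    show "\<bar>cos (of_int k * pi)\<bar> = 1"
      using s by (rule sin_zero_abs_cos_one)
  qed
  ultimately show thesis using that[of \<psi> "cos (of_int k * pi)"] by blast
qed

text \<open>The integrand is \<open>norm v\<close> times the absolute value of a shifted cosine.
  With the shift \<open>\<psi>\<close> within pi / 2 of \<open>a\<close>, the cosine is nonnegative
  up to \<open>\<psi> + pi / 2\<close> and nonpositive after it. The boundary terms at
  \<open>a\<close> and \<open>a + pi\<close> cancel, so the value does not depend on where the half
  circle starts.\<close>

lemma has_integral_abs_inner_dir:
  "((\<lambda>\<theta>. \<bar>dir \<theta> \<bullet> v\<bar>) has_integral 2 * norm v) {a..a + pi}"
proof -
  obtain \<phi> where \<phi>: "v = norm v *\<^sub>R dir \<phi>" by (rule polar_form)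
  obtain \<psi> c where \<psi>: "\<psi> \<in> {a - pi / 2..a + pi / 2}" and c: "dir \<phi> = c *\<^sub>R dir \<psi>" "\<bar>c\<bar> = 1"
    by (rule dir_shift)
  have abs: "\<bar>dir \<theta> \<bullet> v\<bar> = norm v * \<bar>cos (\<theta> - \<psi>)\<bar>" for \<theta>
    by (subst \<phi>) (simp add: c abs_mult inner_dir_dir)
  have 1: "((\<lambda>\<theta>. \<bar>cos (\<theta> - \<psi>)\<bar>) has_integral sin (\<psi> + pi / 2 - \<psi>) - sin (a - \<psi>)) {a..\<psi> + pi / 2}"
  proof (rule has_integral_eq)
    show "((\<lambda>\<theta>. cos (\<theta> - \<psi>)) has_integral sin (\<psi> + pi / 2 - \<psi>) - sin (a - \<psi>)) {a..\<psi> + pi / 2}"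
      using \<psi> by (intro fundamental_theorem_of_calculus)
        (auto intro!: derivative_eq_intros simp flip: has_real_derivative_iff_has_vector_derivative)
    show "cos (\<theta> - \<psi>) = \<bar>cos (\<theta> - \<psi>)\<bar>" if "\<theta> \<in> {a..\<psi> + pi / 2}" for \<theta>
      using that \<psi> cos_ge_zero[of "\<theta> - \<psi>"] by auto
  qed
  have 2: "((\<lambda>\<theta>. \<bar>cos (\<theta> - \<psi>)\<bar>) has_integral - sin (a + pi - \<psi>) - (- sin (\<psi> + pi / 2 - \<psi>))) {\<psi> + pi / 2..a + pi}"
  proof (rule has_integral_eq)
    show "((\<lambda>\<theta>. - cos (\<theta> - \<psi>)) has_integral - sin (a + pi - \<psi>) - (- sin (\<psi> + pi / 2 - \<psi>))) {\<psi> + pi / 2..a + pi}"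
      using \<psi> by (intro fundamental_theorem_of_calculus)
        (auto intro!: derivative_eq_intros simp flip: has_real_derivative_iff_has_vector_derivative)
    show "- cos (\<theta> - \<psi>) = \<bar>cos (\<theta> - \<psi>)\<bar>" if "\<theta> \<in> {\<psi> + pi / 2..a + pi}" for \<theta>
    proof -
      have "cos (\<theta> - \<psi>) = - cos (\<theta> - \<psi> - pi)" by simp
      moreover have "cos (\<theta> - \<psi> - pi) \<ge> 0"
        using that \<psi> by (intro cos_ge_zero) auto
      ultimately show ?thesis by linarith
    qed
  qed
  have "((\<lambda>\<theta>. \<bar>cos (\<theta> - \<psi>)\<bar>) has_integral
      (sin (\<psi> + pi / 2 - \<psi>) - sin (a - \<psi>)) + (- sin (a + pi - \<psi>) - (- sin (\<psi> + pi / 2 - \<psi>)))) {a..a + pi}"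
    using \<psi> by (intro has_integral_combine[OF _ _ 1 2]) auto
  moreover have "sin (a + pi - \<psi>) = - sin (a - \<psi>)"
    by (metis add_diff_eq diff_add_eq sin_periodic_pi)
  ultimately have "((\<lambda>\<theta>. \<bar>cos (\<theta> - \<psi>)\<bar>) has_integral 2) {a..a + pi}"
    by simp
  from has_integral_mult_right[OF this, of "norm v"] show ?thesis
    by (simp add: abs mult.commute)
qed

lemma measure_inner_image_segment:
  "measure lborel ((\<bullet>) e ` closed_segment a b) = \<bar>e \<bullet> (b - a)\<bar>"
proof -
  have "(\<bullet>) e ` closed_segment a b = closed_segment (e \<bullet> a) (e \<bullet> b)"
    by (intro closed_segment_linear_image[symmetric] bounded_linear.linear bounded_linear_inner_right)
  then show ?thesis
    by (simp add: closed_segment_eq_real_ivl inner_diff_right)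
qed

section \<open>From projections of edges to the perimeter\<close>

text \<open>Integrate over \<open>t\<close> the number of edges whose projection contains
  \<open>t\<close>: it is two on the projection of \<open>K\<close> away from the vertices, and zero
  off the projection.\<close>

lemma sum_edge_projections:
  fixes K :: "(real^2) set"
  assumes poly: "polytope K" and dim: "aff_dim K = 2" and e: "e \<noteq> 0"
  shows "(\<Sum>F\<in>{F. F face_of K \<and> aff_dim F = 1}. measure lborel ((\<bullet>) e ` F))
    = 2 * measure lborel ((\<bullet>) e ` K)"
proof -
  define E where "E = {F. F face_of K \<and> aff_dim F = 1}"
  have finE: "finite E"
    using finite_polytope_faces[OF poly] by (rule finite_subset[rotated]) (auto simp: E_def)
  define T where "T = (\<bullet>) e ` {x. x extreme_point_of K}"
  have finT: "finite T"
    unfolding T_def using finite_polyhedron_extreme_points[OF polytope_imp_polyhedron[OF poly]] by simp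
  have comp: "compact ((\<bullet>) e ` F)" if "compact F" for F :: "(real^2) set"
    using that by (intro compact_continuous_image) (auto intro: continuous_intros)
  have compF: "compact F" if "F \<in> E" for F
    using that poly by (auto simp: E_def intro: face_of_polytope_polytope polytope_imp_compact)
  have compK: "compact K" using poly by (rule polytope_imp_compact)
  have int: "integrable lborel (indicat_real ((\<bullet>) e ` F))" if "compact F" for F :: "(real^2) set"
    using comp[OF that] emeasure_bounded_finite[OF compact_imp_bounded[OF comp[OF that]]]
    by (intro integrable_real_indicator) (auto simp: compact_imp_closed borel_closed)
  have "(\<Sum>F\<in>E. measure lborel ((\<bullet>) e ` F)) = (\<Sum>F\<in>E. \<integral>t. indicat_real ((\<bullet>) e ` F) t \<partial>lborel)"
    by simp
  also have "\<dots> = (\<integral>t. (\<Sum>F\<in>E. indicat_real ((\<bullet>) e ` F) t) \<partial>lborel)"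
    by (intro Bochner_Integration.integral_sum[symmetric] int compF)
  also have "\<dots> = (\<integral>t. 2 * indicat_real ((\<bullet>) e ` K) t \<partial>lborel)"
  proof (rule integral_cong_AE)
    \<comment> \<open>The levels of vertices, where the count may differ from two, are finitely many
      and hence null.\<close>
    have "AE t in lborel. t \<notin> T"
      by (rule AE_not_in[OF finite_imp_null_set_lborel[OF finT]])
    then show "AE t in lborel. (\<Sum>F\<in>E. indicat_real ((\<bullet>) e ` F) t) = 2 * indicat_real ((\<bullet>) e ` K) t"
    proof (rule AE_mp, intro AE_I2 impI)
      fix t assume "t \<notin> T"
      have "(\<Sum>F\<in>E. indicat_real ((\<bullet>) e ` F) t) = card {F \<in> E. t \<in> (\<bullet>) e ` F}"
        using finE by (simp add: indicator_def of_bool_def sum.If_cases Int_def)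
      also have "\<dots> = 2 * indicat_real ((\<bullet>) e ` K) t"
      proof (cases "t \<in> (\<bullet>) e ` K")
        case True
        have "{F \<in> E. t \<in> (\<bullet>) e ` F} = {F. F face_of K \<and> aff_dim F = 1 \<and> t \<in> (\<bullet>) e ` F}"
          by (auto simp: E_def)
        then show ?thesis
          using card_edges_on_level[OF poly dim e True] \<open>t \<notin> T\<close> True by (simp add: T_def)
      next
        case False
        then have "{F \<in> E. t \<in> (\<bullet>) e ` F} = {}"
          using face_of_imp_subset by (fastforce simp: E_def)
        then show ?thesis using False by (simp only: card.empty) simp
      qed
      finally show "(\<Sum>F\<in>E. indicat_real ((\<bullet>) e ` F) t) = 2 * indicat_real ((\<bullet>) e ` K) t" .
    qed
  next
    show "(\<lambda>t. \<Sum>F\<in>E. indicat_real ((\<bullet>) e ` F) t) \<in> borel_measurable lborel"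
      by (intro borel_measurable_sum borel_measurable_integrable[OF int] compF)
    show "(\<lambda>t. 2 * indicat_real ((\<bullet>) e ` K) t) \<in> borel_measurable lborel"
      using borel_measurable_integrable[OF int[OF compK]] by (rule borel_measurable_times[OF borel_measurable_const])
  qed
  finally show ?thesis by (simp add: E_def)
qed

text \<open>A segment projects to length \<open>\<bar>e \<bullet> v\<bar>\<close>, which integrates
  to twice its length. For a degenerate \<open>K\<close> this is already the perimeter, as the
  segment counts twice. Otherwise summing over edges gives twice the perimeter on one side and twice
  the width on the other. The start \<open>a\<close> is left free so that the half circle can be
  centred at the drift.\<close>

theorem Cauchy_perimeter_formula:
  fixes K :: "(real^2) set"
  assumes poly: "polytope K"
  shows "((\<lambda>\<theta>. measure lborel ((\<bullet>) (dir \<theta>) ` K)) has_integral polygon_perimeter K) {a..a + pi}"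
proof -
  have segment: "\<exists>v. norm v = diameter F \<and> (\<forall>e. measure lborel ((\<bullet>) e ` F) = \<bar>e \<bullet> v\<bar>)"
    if F1: "polytope F" "aff_dim F \<le> 1" for F :: "(real^2) set"
  proof (cases "F = {}")
    case False
    obtain p q where F: "F = closed_segment p q"
      using compact_convex_collinear_segment[OF False polytope_imp_compact[OF F1(1)]
          polytope_imp_convex[OF F1(1)]] F1(2)
      unfolding collinear_aff_dim by blast
    have "diameter F = norm (q - p)"
    proof (rule antisym)
      show "diameter F \<le> norm (q - p)"
      proof (rule diameter_le)
        fix x y assume "x \<in> F" "y \<in> F"
        then obtain s t where xy: "x = p + s *\<^sub>R (q - p)" "y = p + t *\<^sub>R (q - p)"
          and st: "0 \<le> s" "s \<le> 1" "0 \<le> t" "t \<le> 1"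
          unfolding F in_segment by (auto simp: scaleR_diff_left scaleR_diff_right algebra_simps intro: that)
        have "x - y = (s - t) *\<^sub>R (q - p)"
          unfolding xy by (simp add: scaleR_left_diff_distrib)
        then show "norm (x - y) \<le> norm (q - p)"
          using st by (simp add: mult_left_le_one_le)
      qed simp
      show "norm (q - p) \<le> diameter F"
        unfolding F using diameter_bounded_bound[OF bounded_closed_segment ends_in_segment(1,2), of p q]
        by (simp add: dist_norm norm_minus_commute)
    qed
    then show ?thesis unfolding F using measure_inner_image_segment by metis
  next
    case True
    then have "norm (0::real^2) = diameter F \<and> (\<forall>e. measure lborel ((\<bullet>) e ` F) = \<bar>e \<bullet> (0::real^2)\<bar>)"
      by simp
    then show ?thesis by blast
  qed
  have edge: "((\<lambda>\<theta>. measure lborel ((\<bullet>) (dir \<theta>) ` F)) has_integral 2 * diameter F) {a..a + pi}"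
    if F1: "polytope F" "aff_dim F \<le> 1" for F :: "(real^2) set"
  proof -
    obtain v where "norm v = diameter F" "\<And>e. measure lborel ((\<bullet>) e ` F) = \<bar>e \<bullet> v\<bar>"
      using segment[OF F1] by blast
    then show ?thesis using has_integral_abs_inner_dir[of v a] by simp
  qed
  show ?thesis
  proof (cases "aff_dim K \<le> 1")
    case True
    then show ?thesis using edge[OF poly True] by (simp add: polygon_perimeter_def)
  next
    case False
    have "aff_dim K \<le> 2" using aff_dim_le_DIM[of K] by simp
    then have dim: "aff_dim K = 2" using False by linarith
    have "((\<lambda>\<theta>. \<Sum>F\<in>{F. F face_of K \<and> aff_dim F = 1}. measure lborel ((\<bullet>) (dir \<theta>) ` F)) has_integral
        (\<Sum>F\<in>{F. F face_of K \<and> aff_dim F = 1}. 2 * diameter F)) {a..a + pi}"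
    proof (rule has_integral_sum)
      show "finite {F. F face_of K \<and> aff_dim F = 1}"
        using finite_polytope_faces[OF poly] by (rule finite_subset[rotated]) auto
      show "((\<lambda>\<theta>. measure lborel ((\<bullet>) (dir \<theta>) ` F)) has_integral 2 * diameter F) {a..a + pi}"
        if "F \<in> {F. F face_of K \<and> aff_dim F = 1}" for F
        using that face_of_polytope_polytope[OF poly] by (intro edge) auto
    qed
    then have "((\<lambda>\<theta>. 2 * measure lborel ((\<bullet>) (dir \<theta>) ` K)) has_integral 2 * polygon_perimeter K) {a..a + pi}"
      using False by (simp add: sum_edge_projections[OF poly dim] polygon_perimeter_def sum_distrib_left)
    from has_integral_mult_right[OF this, of "1/2"] show ?thesis by simp
  qed
qed

lemma measure_inner_image_hull:
  fixes V :: "'a::euclidean_space set"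
  assumes "finite V" "V \<noteq> {}"
  shows "measure lborel ((\<bullet>) e ` (convex hull V)) = Max ((\<bullet>) e ` V) - Min ((\<bullet>) e ` V)"
proof -
  have "(\<bullet>) e ` (convex hull V) = convex hull ((\<bullet>) e ` V)"
    by (intro convex_hull_linear_image bounded_linear.linear bounded_linear_inner_right)
  also have "\<dots> = {Min ((\<bullet>) e ` V)..Max ((\<bullet>) e ` V)}"
  proof (rule antisym)
    show "convex hull ((\<bullet>) e ` V) \<subseteq> {Min ((\<bullet>) e ` V)..Max ((\<bullet>) e ` V)}"
      using assms by (intro hull_minimal) (auto simp: convex_closed_interval)
    have "closed_segment (Min ((\<bullet>) e ` V)) (Max ((\<bullet>) e ` V)) \<subseteq> convex hull ((\<bullet>) e ` V)"
      using assms by (intro closed_segment_subset hull_inc Min_in Max_in convex_convex_hull) auto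
    then show "{Min ((\<bullet>) e ` V)..Max ((\<bullet>) e ` V)} \<subseteq> convex hull ((\<bullet>) e ` V)"
      by (metis atLeastatMost_empty_iff closed_segment_eq_real_ivl1 empty_subsetI)
  qed
  finally have "(\<bullet>) e ` (convex hull V) = {Min ((\<bullet>) e ` V)..Max ((\<bullet>) e ` V)}" .
  moreover have "Min ((\<bullet>) e ` V) \<le> Max ((\<bullet>) e ` V)"
    using assms by (meson Max_ge Min_in finite_imageI image_is_empty)
  ultimately show ?thesis by simp
qed

subsection \<open>Maxima of random walks with negative drift\<close>

text \<open>Lindley's recursion, known from waiting times in queues: a walk reflected at 0. Its
  value is the largest suffix sum, the empty one included. The recursive form carries moments one
  step further, as the new step is independent of the current value.\<close>

fun lindley :: "(nat \<Rightarrow> real) \<Rightarrow> nat \<Rightarrow> real" where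
  "lindley y 0 = 0"
| "lindley y (Suc n) = max 0 (lindley y n + y (Suc n))"

definition runmax :: "(nat \<Rightarrow> real) \<Rightarrow> nat \<Rightarrow> real" where
  "runmax y n = Max ((\<lambda>k. \<Sum>i\<in>{1..k}. y i) ` {0..n})"

lemma lindley_nonneg: "lindley y n \<ge> 0"
  by (cases n) auto

lemma lindley_cong: "(\<And>i. i \<in> {1..n} \<Longrightarrow> y i = z i) \<Longrightarrow> lindley y n = lindley z n"
  by (induction n) auto

text \<open>The positive part is monotone and subadditive. This is what allows each step to be split
  into a truncated part and a remainder that are then treated separately.\<close>

lemma lindley_subadditive: "lindley (\<lambda>i. y i + z i) n \<le> lindley y n + lindley z n"
  by (induction n) (auto simp: lindley_nonneg)

lemma lindley_le:
  assumes "\<And>i. i \<in> {1..n} \<Longrightarrow> \<bar>y i\<bar> \<le> b"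
  shows "lindley y n \<le> real n * b"
  using assms
proof (induction n)
  case (Suc n)
  then have "lindley y n \<le> real n * b" "\<bar>y (Suc n)\<bar> \<le> b" by auto
  moreover have "0 \<le> real n * b" using Suc.prems[of "Suc n"] by (auto intro: order_trans[OF abs_ge_zero])
  ultimately show ?case by (auto simp: algebra_simps)
qed simp

text \<open>A new step is added to every old suffix sum, and the new index \<open>k = Suc n\<close>
  contributes the empty sum, which is the 0 in \<open>max 0\<close>.\<close>

lemma lindley_eq_Max: "lindley y n = Max ((\<lambda>k. \<Sum>i\<in>{k+1..n}. y i) ` {0..n})"
proof (induction n)
  case (Suc n)
  have "(\<lambda>k. \<Sum>i\<in>{k+1..Suc n}. y i) ` {0..n} = (\<lambda>t. t + y (Suc n)) ` (\<lambda>k. \<Sum>i\<in>{k+1..n}. y i) ` {0..n}"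
    unfolding image_image by (rule image_cong) auto
  then have "(\<lambda>k. \<Sum>i\<in>{k+1..Suc n}. y i) ` {0..Suc n}
      = insert 0 ((\<lambda>t. t + y (Suc n)) ` (\<lambda>k. \<Sum>i\<in>{k+1..n}. y i) ` {0..n})"
    unfolding atLeast0_atMost_Suc image_insert by simp
  then have "Max ((\<lambda>k. \<Sum>i\<in>{k+1..Suc n}. y i) ` {0..Suc n})
      = max 0 (Max ((\<lambda>t. t + y (Suc n)) ` (\<lambda>k. \<Sum>i\<in>{k+1..n}. y i) ` {0..n}))"
    using Max_insert[of "(\<lambda>t. t + y (Suc n)) ` (\<lambda>k. \<Sum>i\<in>{k+1..n}. y i) ` {0..n}" 0] by simp
  also have "Max ((\<lambda>t. t + y (Suc n)) ` (\<lambda>k. \<Sum>i\<in>{k+1..n}. y i) ` {0..n}) = lindley y n + y (Suc n)"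
    unfolding Suc by (rule mono_Max_commute[symmetric]) (auto simp: mono_def)
  finally show ?case by simp
qed simp

text \<open>Reversing the order of the first \<open>n\<close> steps turns the prefix of length
  \<open>k\<close> into the suffix that starts after \<open>n - k\<close>. The identity holds path
  by path; equality in law is a consequence for i.i.d. steps.\<close>

lemma runmax_eq_lindley_rev: "runmax y n = lindley (\<lambda>i. y (n + 1 - i)) n"
proof -
  have "(\<Sum>i\<in>{n-k+1..n}. y (n + 1 - i)) = (\<Sum>i\<in>{1..k}. y i)" if "k \<le> n" for k
    by (rule sum.reindex_bij_witness[of _ "\<lambda>i. n + 1 - i" "\<lambda>i. n + 1 - i"]) (use that in auto)
  then have "(\<lambda>k. \<Sum>i\<in>{1..k}. y i) ` {0..n} = (\<lambda>k. \<Sum>i\<in>{n-k+1..n}. y (n + 1 - i)) ` {0..n}"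
    by (intro image_cong) auto
  also have "\<dots> = (\<lambda>k. \<Sum>i\<in>{k+1..n}. y (n + 1 - i)) ` (\<lambda>k. n - k) ` {0..n}"
    by (simp add: image_image)
  also have "(\<lambda>k. n - k) ` {0..n} = {0..n}"
    by (auto simp: image_iff) (metis diff_diff_cancel diff_le_self atLeastAtMost_iff le0)
  finally show ?thesis by (simp add: runmax_def lindley_eq_Max)
qed

lemma runmax_nonneg: "runmax y n \<ge> 0"
  by (simp add: runmax_eq_lindley_rev lindley_nonneg)

lemma runmax_mono: "runmax y n \<le> runmax y (Suc n)"
  unfolding runmax_def by (intro Max_mono) auto

lemma lindley_measurable:
  assumes "\<And>i. i \<in> {1..n} \<Longrightarrow> (\<lambda>x. y x i) \<in> borel_measurable N"
  shows "(\<lambda>x. lindley (y x) n) \<in> borel_measurable N"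
  using assms by (induction n) auto

text \<open>For \<open>m + y \<ge> 0\<close> this is the binomial expansion. For
  \<open>m + y < 0\<close> the left side is 0 while the expansion is negative; the absolute value in
  the last term makes the right side nonnegative, being \<open>3 m \<bar>y\<bar> (\<bar>y\<bar> - m)
  + m ^ 3 + \<bar>y\<bar> ^ 3\<close> with \<open>m < \<bar>y\<bar>\<close>.\<close>

lemma cube_pos_part_le:
  fixes m y :: real
  assumes "m \<ge> 0"
  shows "(max 0 (m + y)) ^ 3 \<le> m ^ 3 + 3 * m\<^sup>2 * y + 3 * m * y\<^sup>2 + \<bar>y\<bar> ^ 3"
proof (cases "m + y \<ge> 0")
  case True
  have "(m + y) ^ 3 = m ^ 3 + 3 * m\<^sup>2 * y + 3 * m * y\<^sup>2 + y ^ 3"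
    by (simp add: power3_eq_cube power2_eq_square algebra_simps)
  moreover have "y ^ 3 \<le> \<bar>y\<bar> ^ 3" by (metis abs_ge_self power_abs)
  ultimately show ?thesis using True by (simp add: max_def)
next
  case False
  then have y: "y < 0" "- y - m \<ge> 0" using assms by linarith+
  have "0 \<le> 3 * m * (- y) * (- y - m) + m ^ 3 + (- y) ^ 3"
    using assms y by (intro add_nonneg_nonneg mult_nonneg_nonneg zero_le_power) auto
  also have "\<dots> = m ^ 3 + 3 * m\<^sup>2 * y + 3 * m * y\<^sup>2 + \<bar>y\<bar> ^ 3"
    using y(1) by (simp add: power3_eq_cube power2_eq_square algebra_simps)
  finally show ?thesis using False by (simp add: max_def)
qed

section \<open>Moments of the reflected walk for i.i.d. steps\<close>

text \<open>Several instances share the measure \<open>M\<close>: the projected steps for each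
  direction, their truncated parts and remainders, and the centred component along the
  drift.\<close>

locale iid_sequence = prob_space +
  fixes Y :: "nat \<Rightarrow> 'a \<Rightarrow> real"
  assumes indep: "indep_vars (\<lambda>_. borel) Y {1..}"
    and ident: "\<And>i. i \<ge> 1 \<Longrightarrow> distr M borel (Y i) = distr M borel (Y 1)"
    and square_integrable: "integrable M (\<lambda>\<omega>. (Y 1 \<omega>)\<^sup>2)"
begin

lemma Y_measurable [measurable]: "i \<ge> 1 \<Longrightarrow> Y i \<in> borel_measurable M"
  using indep by (auto simp: indep_vars_def)

lemma expectation_transfer:
  fixes g :: "real \<Rightarrow> real"
  assumes "i \<ge> 1" "g \<in> borel_measurable borel"
  shows "expectation (\<lambda>\<omega>. g (Y i \<omega>)) = expectation (\<lambda>\<omega>. g (Y 1 \<omega>))"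
    and "integrable M (\<lambda>\<omega>. g (Y i \<omega>)) \<longleftrightarrow> integrable M (\<lambda>\<omega>. g (Y 1 \<omega>))"
proof -
  have "random_variable borel (Y i)" "random_variable borel (Y 1)"
    using assms(1) by auto
  then show "expectation (\<lambda>\<omega>. g (Y i \<omega>)) = expectation (\<lambda>\<omega>. g (Y 1 \<omega>))"
    "integrable M (\<lambda>\<omega>. g (Y i \<omega>)) \<longleftrightarrow> integrable M (\<lambda>\<omega>. g (Y 1 \<omega>))"
    using integral_distr[of _ M borel g] integrable_distr_eq[of _ M borel g] assms(2) ident[OF assms(1)]
    by metis+
qed

lemma Y_square_integrable: "i \<ge> 1 \<Longrightarrow> integrable M (\<lambda>\<omega>. (Y i \<omega>)\<^sup>2)"
  using expectation_transfer(2)[of i "\<lambda>x. x\<^sup>2"] square_integrable by simp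

lemma Y_integrable: "i \<ge> 1 \<Longrightarrow> integrable M (Y i)"
  by (rule square_integrable_imp_integrable) (auto intro: Y_square_integrable)

definition W :: "nat \<Rightarrow> 'a \<Rightarrow> real" where
  "W n \<omega> = lindley (\<lambda>i. Y i \<omega>) n"

lemma W_measurable [measurable]: "W n \<in> borel_measurable M"
  unfolding W_def by (rule lindley_measurable) auto

lemma W_nonneg: "W n \<omega> \<ge> 0"
  by (simp add: W_def lindley_nonneg)

lemma W_Suc: "W (Suc n) \<omega> = max 0 (W n \<omega> + Y (Suc n) \<omega>)"
  by (simp add: W_def)

lemma runmax_measurable [measurable]: "(\<lambda>\<omega>. runmax (\<lambda>i. Y i \<omega>) n) \<in> borel_measurable M"
  unfolding runmax_eq_lindley_rev by (rule lindley_measurable) auto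

text \<open>Time reversal of an i.i.d. sequence.\<close>

lemma distr_runmax: "distr M borel (\<lambda>\<omega>. runmax (\<lambda>i. Y i \<omega>) n) = distr M borel (W n)"
\<comment> \<open>The product description of the joint law is applied to a nonempty index set, so
  \<open>n = 0\<close> is treated apart.\<close>
proof (cases "n = 0")
  case True
  then show ?thesis by (intro distr_cong) (auto simp: runmax_def W_def)
next
  case False
  define I where "I = {1..n}"
  define D where "D = distr M borel (Y 1)"
  define P where "P = PiM I (\<lambda>_. D)"
  define R where "R = (\<lambda>y::nat \<Rightarrow> real. \<lambda>i\<in>I. y (n + 1 - i))"
  define X where "X = (\<lambda>\<omega>. \<lambda>i\<in>I. Y i \<omega>)"
  have sP: "sets P = sets (PiM I (\<lambda>_. borel))"
    unfolding P_def by (intro sets_PiM_cong) (auto simp: D_def)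
  have X: "X \<in> measurable M P"
    unfolding measurable_cong_sets[OF refl sP] X_def by (intro measurable_restrict) (auto simp: I_def)
  have "distr M (PiM I (\<lambda>_. borel)) X = PiM I (\<lambda>i. distr M borel (Y i))"
    unfolding X_def
  proof (rule iffD1[OF indep_vars_iff_distr_eq_PiM'])
    show "indep_vars (\<lambda>_. borel) Y I"
      by (rule indep_vars_subset[OF indep]) (auto simp: I_def)
  qed (use False in \<open>auto simp: I_def\<close>)
  also have "\<dots> = P"
    unfolding P_def D_def by (intro PiM_cong refl ident) (simp add: I_def)
  finally have "distr M (PiM I (\<lambda>_. borel)) X = P" .
  moreover have "distr M P X = distr M (PiM I (\<lambda>_. borel)) X"
    by (rule distr_cong[OF refl sP refl])
  ultimately have dX: "distr M P X = P" by (rule trans[rotated])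
  \<comment> \<open>A product of equal factors is invariant under the permutation
    \<open>n + 1 - i\<close> of the indices.\<close>
  have dR: "distr P P R = P"
    unfolding P_def R_def
  proof (rule distr_PiM_reindex[where M = "\<lambda>_. D" and f = "\<lambda>i. n + 1 - i"])
    show "prob_space D" unfolding D_def by (rule prob_space_distr) simp
  qed (auto simp: I_def inj_on_def)
  have mL: "(\<lambda>y. lindley y n) \<in> borel_measurable P"
    unfolding measurable_cong_sets[OF sP refl]
    by (intro lindley_measurable measurable_component_singleton) (auto simp: I_def)
  have mR: "R \<in> measurable P P"
    unfolding measurable_cong_sets[OF sP sP] R_def
    by (intro measurable_restrict measurable_component_singleton) (auto simp: I_def)
  have "distr M borel (\<lambda>\<omega>. runmax (\<lambda>i. Y i \<omega>) n) = distr M borel ((\<lambda>y. lindley y n) \<circ> (R \<circ> X))"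
    unfolding runmax_eq_lindley_rev
    by (intro distr_cong refl) (auto simp: R_def X_def I_def intro!: lindley_cong)
  also have "\<dots> = distr (distr (distr M P X) P R) borel (\<lambda>y. lindley y n)"
    unfolding distr_distr[OF mR X] distr_distr[OF mL measurable_comp[OF X mR]] ..
  also have "\<dots> = distr (distr M P X) borel (\<lambda>y. lindley y n)"
    unfolding dX dR ..
  also have "\<dots> = distr M borel ((\<lambda>y. lindley y n) \<circ> X)"
    by (rule distr_distr[OF mL X])
  also have "\<dots> = distr M borel (W n)"
    by (intro distr_cong refl) (auto simp: X_def W_def I_def intro!: lindley_cong)
  finally show ?thesis .
qed

lemma expectation_runmax:
  fixes g :: "real \<Rightarrow> real"
  assumes [measurable]: "g \<in> borel_measurable borel"
  shows "expectation (\<lambda>\<omega>. g (runmax (\<lambda>i. Y i \<omega>) n)) = expectation (\<lambda>\<omega>. g (W n \<omega>))"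
    and "integrable M (\<lambda>\<omega>. g (runmax (\<lambda>i. Y i \<omega>) n)) \<longleftrightarrow> integrable M (\<lambda>\<omega>. g (W n \<omega>))"
proof -
  show "expectation (\<lambda>\<omega>. g (runmax (\<lambda>i. Y i \<omega>) n)) = expectation (\<lambda>\<omega>. g (W n \<omega>))"
    by (subst (1 2) integral_distr[symmetric, where N = borel and f = g]) (auto simp: distr_runmax)
  show "integrable M (\<lambda>\<omega>. g (runmax (\<lambda>i. Y i \<omega>) n)) \<longleftrightarrow> integrable M (\<lambda>\<omega>. g (W n \<omega>))"
    by (subst (1 2) integrable_distr_eq[symmetric, where N = borel and f = g]) (auto simp: distr_runmax)
qed

lemma indep_W: "indep_var borel (W n) borel (Y (Suc n))"
proof -
  have "indep_var borel ((\<lambda>y. lindley y n) \<circ> (\<lambda>\<omega>. \<lambda>i\<in>{1..n}. Y i \<omega>))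
      borel ((\<lambda>y. y (Suc n)) \<circ> (\<lambda>\<omega>. \<lambda>i\<in>{Suc n}. Y i \<omega>))"
    by (intro indep_var_compose[OF indep_var_restrict[OF indep]] lindley_measurable measurable_component_singleton) auto
  also have "(\<lambda>y. lindley y n) \<circ> (\<lambda>\<omega>. \<lambda>i\<in>{1..n}. Y i \<omega>) = W n"
    by (auto simp: fun_eq_iff W_def intro!: lindley_cong)
  also have "(\<lambda>y. y (Suc n)) \<circ> (\<lambda>\<omega>. \<lambda>i\<in>{Suc n}. Y i \<omega>) = Y (Suc n)"
    by auto
  finally show ?thesis .
qed

lemma expectation_W_mult:
  fixes f g :: "real \<Rightarrow> real"
  assumes "f \<in> borel_measurable borel" "g \<in> borel_measurable borel"
    and "integrable M (\<lambda>\<omega>. f (W n \<omega>))" "integrable M (\<lambda>\<omega>. g (Y 1 \<omega>))"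
  shows "expectation (\<lambda>\<omega>. f (W n \<omega>) * g (Y (Suc n) \<omega>)) = expectation (\<lambda>\<omega>. f (W n \<omega>)) * expectation (\<lambda>\<omega>. g (Y 1 \<omega>))"
    and "integrable M (\<lambda>\<omega>. f (W n \<omega>) * g (Y (Suc n) \<omega>))"
proof -
  have "indep_var borel (f \<circ> W n) borel (g \<circ> Y (Suc n))"
    by (rule indep_var_compose[OF indep_W assms(1,2)])
  from indep_var_lebesgue_integral[OF this] indep_var_integrable[OF this]
  show "expectation (\<lambda>\<omega>. f (W n \<omega>) * g (Y (Suc n) \<omega>)) = expectation (\<lambda>\<omega>. f (W n \<omega>)) * expectation (\<lambda>\<omega>. g (Y 1 \<omega>))"
    "integrable M (\<lambda>\<omega>. f (W n \<omega>) * g (Y (Suc n) \<omega>))"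
    using assms(3,4) expectation_transfer[of "Suc n" g] assms(2) by (auto simp: comp_def)
qed

lemma W_square_integrable: "integrable M (\<lambda>\<omega>. (W n \<omega>)\<^sup>2)"
proof (induction n)
  case 0
  then show ?case by (simp add: W_def)
next
  case (Suc n)
  show ?case
  proof (rule Bochner_Integration.integrable_bound)
    show "integrable M (\<lambda>\<omega>. 2 * (W n \<omega>)\<^sup>2 + 2 * (Y (Suc n) \<omega>)\<^sup>2)"
      using Suc Y_square_integrable[of "Suc n"] by simp
    have "(max 0 (m + y))\<^sup>2 \<le> 2 * m\<^sup>2 + 2 * y\<^sup>2" for m y :: real
    proof -
      have "(max 0 (m + y))\<^sup>2 \<le> (m + y)\<^sup>2" by (auto simp: max_def)
      then show ?thesis using sum_squares_bound[of m y] by (simp add: power2_sum)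
    qed
    then show "AE \<omega> in M. norm ((W (Suc n) \<omega>)\<^sup>2) \<le> norm (2 * (W n \<omega>)\<^sup>2 + 2 * (Y (Suc n) \<omega>)\<^sup>2)"
      by (simp add: W_Suc)
  qed simp
qed

lemma W_integrable: "integrable M (W n)"
  by (rule square_integrable_imp_integrable) (auto intro: W_square_integrable)

text \<open>Dropping the positive part only enlarges the square. The cross term factors by
  independence and is nonpositive, so each step adds at most the second moment of one step. Mean
  zero is allowed, as needed for the centred remainder and for directions orthogonal to the
  drift.\<close>

lemma W_square_le:
  assumes "expectation (Y 1) \<le> 0"
  shows "expectation (\<lambda>\<omega>. (W n \<omega>)\<^sup>2) \<le> real n * expectation (\<lambda>\<omega>. (Y 1 \<omega>)\<^sup>2)"
proof (induction n)
  case 0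
  then show ?case by (simp add: W_def)
next
  case (Suc n)
  note int = W_square_integrable[of n] Y_square_integrable[of "Suc n"]
    expectation_W_mult[of "\<lambda>x. x" "\<lambda>x. x" n] W_integrable Y_integrable[of 1]
  have "expectation (\<lambda>\<omega>. (W (Suc n) \<omega>)\<^sup>2)
      \<le> expectation (\<lambda>\<omega>. (W n \<omega>)\<^sup>2 + 2 * (W n \<omega> * Y (Suc n) \<omega>) + (Y (Suc n) \<omega>)\<^sup>2)"
  proof (intro integral_mono W_square_integrable)
    have "(max 0 (m + y))\<^sup>2 \<le> m\<^sup>2 + 2 * (m * y) + y\<^sup>2" for m y :: real
    proof -
      have "(max 0 (m + y))\<^sup>2 \<le> (m + y)\<^sup>2" by (auto simp: max_def)
      then show ?thesis by (simp add: power2_sum algebra_simps)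
    qed
    then show "(W (Suc n) \<omega>)\<^sup>2 \<le> (W n \<omega>)\<^sup>2 + 2 * (W n \<omega> * Y (Suc n) \<omega>) + (Y (Suc n) \<omega>)\<^sup>2" for \<omega>
      by (simp add: W_Suc)
  qed (use int in auto)
  also have "\<dots> = expectation (\<lambda>\<omega>. (W n \<omega>)\<^sup>2) + 2 * (expectation (W n) * expectation (Y 1)) + expectation (\<lambda>\<omega>. (Y 1 \<omega>)\<^sup>2)"
    using int expectation_transfer(1)[of "Suc n" "\<lambda>x. x\<^sup>2"] by simp
  also have "expectation (W n) * expectation (Y 1) \<le> 0"
    using assms W_nonneg by (intro mult_nonneg_nonpos integral_nonneg) auto
  finally show ?case using Suc by (simp add: algebra_simps)
qed

text \<open>The running maximum is monotone in n and has the same law as W n, so the third moment of W n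
  cannot decrease; the negative drift makes that impossible once the second moment is large.\<close>

lemma W_square_bounded:
  assumes neg: "expectation (Y 1) < 0"
    and bound: "\<And>i \<omega>. i \<ge> 1 \<Longrightarrow> \<omega> \<in> space M \<Longrightarrow> \<bar>Y i \<omega>\<bar> \<le> b"
  obtains C where "\<And>n. expectation (\<lambda>\<omega>. (W n \<omega>)\<^sup>2) \<le> C"
proof -
  define c where "c = - expectation (Y 1)"
  define v where "v = expectation (\<lambda>\<omega>. (Y 1 \<omega>)\<^sup>2)"
  define \<rho> where "\<rho> = expectation (\<lambda>\<omega>. \<bar>Y 1 \<omega>\<bar> ^ 3)"
  have c: "c > 0" using neg by (simp add: c_def)
  have intY3: "integrable M (\<lambda>\<omega>. \<bar>Y i \<omega>\<bar> ^ 3)" if "i \<ge> 1" for i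
    by (rule integrable_const_bound[of _ "b ^ 3"])
      (use that bound in \<open>auto intro!: AE_I2 power_mono\<close>)
  have intW3: "integrable M (\<lambda>\<omega>. (W n \<omega>) ^ 3)" for n
  proof (rule integrable_const_bound[of _ "(real n * b) ^ 3"])
    have "W n \<omega> ^ 3 \<le> (real n * b) ^ 3" if "\<omega> \<in> space M" for \<omega>
      using bound[OF _ that] W_nonneg by (intro power_mono) (auto simp: W_def intro!: lindley_le)
    then show "AE \<omega> in M. norm (W n \<omega> ^ 3) \<le> (real n * b) ^ 3"
      using W_nonneg by auto
  qed simp
  \<comment> \<open>Comparing third moments at \<open>n\<close> and \<open>Suc n\<close> gives
    \<open>3 * c * E W^2 \<le> 3 * v * E W + \<rho>\<close>. The linear term is at most
    \<open>3 * c / 2 * E W^2 + 3 * v^2 / (2 * c)\<close> by completing the square, so half of the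
    left side absorbs it.\<close>
  have "expectation (\<lambda>\<omega>. (W n \<omega>)\<^sup>2) \<le> (3 * v\<^sup>2 / (2 * c) + \<rho>) / (3 * c / 2)" for n
  proof -
    have m1: "expectation (\<lambda>\<omega>. (W n \<omega>)\<^sup>2 * Y (Suc n) \<omega>) = expectation (\<lambda>\<omega>. (W n \<omega>)\<^sup>2) * expectation (Y 1)"
        "integrable M (\<lambda>\<omega>. (W n \<omega>)\<^sup>2 * Y (Suc n) \<omega>)"
      by (rule expectation_W_mult[of "\<lambda>x. x\<^sup>2" "\<lambda>x. x" n]; use W_square_integrable[of n] Y_integrable[of 1] in simp)+
    have m2: "expectation (\<lambda>\<omega>. W n \<omega> * (Y (Suc n) \<omega>)\<^sup>2) = expectation (W n) * v"
        "integrable M (\<lambda>\<omega>. W n \<omega> * (Y (Suc n) \<omega>)\<^sup>2)"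
      unfolding v_def
      by (rule expectation_W_mult[of "\<lambda>x. x" "\<lambda>x. x\<^sup>2" n]; use W_integrable[of n] square_integrable in simp)+
    have t3: "expectation (\<lambda>\<omega>. \<bar>Y (Suc n) \<omega>\<bar> ^ 3) = \<rho>"
      unfolding \<rho>_def by (rule expectation_transfer(1)) auto
    note int [simp] = intW3[of n] intY3[of "Suc n", OF le_add1[of 1 n, unfolded plus_1_eq_Suc]] W_square_integrable[of n] W_integrable[of n] m1(2) m2(2)
    have "expectation (\<lambda>\<omega>. (W n \<omega>) ^ 3) = expectation (\<lambda>\<omega>. (runmax (\<lambda>i. Y i \<omega>) n) ^ 3)"
      by (simp add: expectation_runmax(1)[of "\<lambda>x. x ^ 3"])
    also have "\<dots> \<le> expectation (\<lambda>\<omega>. (runmax (\<lambda>i. Y i \<omega>) (Suc n)) ^ 3)"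
      using intW3 expectation_runmax(2)[of "\<lambda>x. x ^ 3"]
      by (intro integral_mono power_mono runmax_mono runmax_nonneg) auto
    also have "\<dots> = expectation (\<lambda>\<omega>. (W (Suc n) \<omega>) ^ 3)"
      by (simp add: expectation_runmax(1)[of "\<lambda>x. x ^ 3"])
    also have "\<dots> \<le> expectation (\<lambda>\<omega>. (W n \<omega>) ^ 3 + 3 * ((W n \<omega>)\<^sup>2 * Y (Suc n) \<omega>)
        + 3 * (W n \<omega> * (Y (Suc n) \<omega>)\<^sup>2) + \<bar>Y (Suc n) \<omega>\<bar> ^ 3)"
    proof (intro integral_mono intW3)
      show "(W (Suc n) \<omega>) ^ 3 \<le> (W n \<omega>) ^ 3 + 3 * ((W n \<omega>)\<^sup>2 * Y (Suc n) \<omega>)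
          + 3 * (W n \<omega> * (Y (Suc n) \<omega>)\<^sup>2) + \<bar>Y (Suc n) \<omega>\<bar> ^ 3" for \<omega>
        using cube_pos_part_le[OF W_nonneg[of n \<omega>], of "Y (Suc n) \<omega>"] by (simp only: W_Suc mult.assoc)
    qed simp
    also have "\<dots> = expectation (\<lambda>\<omega>. (W n \<omega>) ^ 3) + 3 * (expectation (\<lambda>\<omega>. (W n \<omega>)\<^sup>2) * (- c))
        + 3 * (expectation (W n) * v) + \<rho>"
      by (simp add: m1(1) m2(1) t3 c_def v_def)
    finally have 1: "3 * c * expectation (\<lambda>\<omega>. (W n \<omega>)\<^sup>2) \<le> 3 * v * expectation (W n) + \<rho>"
      by (simp add: algebra_simps)
    have "3 * v * expectation (W n) = expectation (\<lambda>\<omega>. 3 * v * W n \<omega>)"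
      by simp
    also have "\<dots> \<le> expectation (\<lambda>\<omega>. 3 * c / 2 * (W n \<omega>)\<^sup>2 + 3 * v\<^sup>2 / (2 * c))"
    proof (intro integral_mono)
      fix \<omega>
      define m where "m = W n \<omega>"
      have "0 \<le> 3 / (2 * c) * (c * m - v)\<^sup>2" using c by simp
      also have "3 / (2 * c) * (c * m - v)\<^sup>2 = 3 * c / 2 * m\<^sup>2 + 3 * v\<^sup>2 / (2 * c) - 3 * v * m"
        using c by (simp add: field_simps power2_eq_square)
      finally show "3 * v * W n \<omega> \<le> 3 * c / 2 * (W n \<omega>)\<^sup>2 + 3 * v\<^sup>2 / (2 * c)"
        by (simp add: m_def)
    qed simp_all
    also have "\<dots> = 3 * c / 2 * expectation (\<lambda>\<omega>. (W n \<omega>)\<^sup>2) + 3 * v\<^sup>2 / (2 * c)"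
      by (simp add: prob_space)
    finally have "3 * c / 2 * expectation (\<lambda>\<omega>. (W n \<omega>)\<^sup>2) \<le> 3 * v\<^sup>2 / (2 * c) + \<rho>"
      using 1 by (simp add: algebra_simps)
    then show ?thesis using c by (simp add: field_simps)
  qed
  then show thesis by (rule that)
qed

lemma iid_compose:
  fixes g :: "real \<Rightarrow> real"
  assumes [measurable]: "g \<in> borel_measurable borel" and bound: "\<And>x. \<bar>g x\<bar> \<le> \<bar>x\<bar> + r"
  shows "iid_sequence M (\<lambda>i \<omega>. g (Y i \<omega>))"
proof
  show "indep_vars (\<lambda>_. borel) (\<lambda>i \<omega>. g (Y i \<omega>)) {1..}"
    by (rule indep_vars_compose2[OF indep]) simp
  show "distr M borel (\<lambda>\<omega>. g (Y i \<omega>)) = distr M borel (\<lambda>\<omega>. g (Y 1 \<omega>))" if "i \<ge> 1" for i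
  proof -
    have "distr M borel (\<lambda>\<omega>. g (Y j \<omega>)) = distr (distr M borel (Y j)) borel g" if "j \<ge> 1" for j
      using that by (subst distr_distr) (auto simp: comp_def)
    from this[OF that] this[of 1] show ?thesis using ident[OF that] by simp
  qed
  show "integrable M (\<lambda>\<omega>. (g (Y 1 \<omega>))\<^sup>2)"
  proof (rule Bochner_Integration.integrable_bound)
    show "integrable M (\<lambda>\<omega>. 2 * (Y 1 \<omega>)\<^sup>2 + 2 * r\<^sup>2)"
      using square_integrable by simp
    have "(g x)\<^sup>2 \<le> 2 * x\<^sup>2 + 2 * r\<^sup>2" for x
    proof -
      have "(g x)\<^sup>2 \<le> (\<bar>x\<bar> + r)\<^sup>2"
        using bound[of x] by (metis abs_ge_zero power2_abs power_mono)
      also have "\<dots> \<le> 2 * x\<^sup>2 + 2 * r\<^sup>2"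
        using sum_squares_bound[of "\<bar>x\<bar>" r] by (simp add: power2_sum)
      finally show ?thesis .
    qed
    then show "AE \<omega> in M. norm ((g (Y 1 \<omega>))\<^sup>2) \<le> norm (2 * (Y 1 \<omega>)\<^sup>2 + 2 * r\<^sup>2)"
      by simp
  qed simp
qed

text \<open>Only two moments are available, so split each step into a bounded part that keeps the negative
  drift, whose W has bounded second moment, and a centred remainder of small variance.\<close>

lemma W_square_over_n_tendsto_0:
  assumes neg: "expectation (Y 1) < 0"
  shows "(\<lambda>n. expectation (\<lambda>\<omega>. (W n \<omega>)\<^sup>2) / real n) \<longlonglongrightarrow> 0"
proof -
  define clamp where "clamp K y = max (- real K) (min (real K) y)" for K y
  define res where "res K y = y - clamp K y" for K y
  have [measurable]: "clamp K \<in> borel_measurable borel" "res K \<in> borel_measurable borel" for K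
    unfolding clamp_def res_def by measurable
  have clamp_bound: "\<bar>clamp K y\<bar> \<le> real K" for K y
    by (auto simp: clamp_def)
  have res_bound: "\<bar>res K y\<bar> \<le> \<bar>y\<bar>" for K y
    by (auto simp: clamp_def res_def)
  \<comment> \<open>The residual vanishes at each point once \<open>K\<close> exceeds the step
    there, and its square is dominated by that of the step.\<close>
  have lim: "(\<lambda>K. expectation (\<lambda>\<omega>. (res K (Y 1 \<omega>))\<^sup>2)) \<longlonglongrightarrow> expectation (\<lambda>\<omega>. 0)"
  proof (rule integral_dominated_convergence[where w = "\<lambda>\<omega>. (Y 1 \<omega>)\<^sup>2"])
    show "AE \<omega> in M. norm ((res K (Y 1 \<omega>))\<^sup>2) \<le> (Y 1 \<omega>)\<^sup>2" for K
      using res_bound by (auto simp: abs_le_square_iff)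
    have "(\<lambda>K. (res K y)\<^sup>2) \<longlonglongrightarrow> 0" for y
    proof (rule tendsto_eventually)
      obtain k where "\<bar>y\<bar> \<le> real k" using real_arch_simple by blast
      then have "(res K y)\<^sup>2 = 0" if "K \<ge> k" for K
        using that by (auto simp: res_def clamp_def)
      then show "\<forall>\<^sub>F K in sequentially. (res K y)\<^sup>2 = 0"
        by (auto simp: eventually_sequentially)
    qed
    then show "AE \<omega> in M. (\<lambda>K. (res K (Y 1 \<omega>))\<^sup>2) \<longlonglongrightarrow> 0" by simp
  qed (use square_integrable in auto)
  have key: "\<exists>C. \<forall>n. expectation (\<lambda>\<omega>. (W n \<omega>)\<^sup>2) \<le> 2 * C + 2 * (real n * e)" if e: "e > 0" for e
  proof -
    obtain K where K: "expectation (\<lambda>\<omega>. (res K (Y 1 \<omega>))\<^sup>2) < e"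
      using order_tendstoD(2)[OF lim, of e] e by (auto simp: eventually_sequentially)
    \<comment> \<open>Moving the mean of the residual to the clamped part centres the remainder and
      leaves the clamped part with exactly the original drift, whatever \<open>K\<close> is.\<close>
    define r where "r = expectation (\<lambda>\<omega>. res K (Y 1 \<omega>))"
    interpret A: iid_sequence M "\<lambda>i \<omega>. clamp K (Y i \<omega>) + r"
    proof (rule iid_compose)
      show "\<bar>clamp K x + r\<bar> \<le> \<bar>x\<bar> + (real K + \<bar>r\<bar>)" for x
        using clamp_bound[of K x] by linarith
    qed simp
    interpret B: iid_sequence M "\<lambda>i \<omega>. res K (Y i \<omega>) - r"
    proof (rule iid_compose)
      show "\<bar>res K x - r\<bar> \<le> \<bar>x\<bar> + \<bar>r\<bar>" for x
        using res_bound[of K x] by linarith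
    qed simp
    interpret R: iid_sequence M "\<lambda>i \<omega>. res K (Y i \<omega>)"
      by (rule iid_compose[where r = 0]) (use res_bound in auto)
    have intR: "integrable M (\<lambda>\<omega>. res K (Y 1 \<omega>))" "integrable M (\<lambda>\<omega>. (res K (Y 1 \<omega>))\<^sup>2)"
      using R.Y_integrable[of 1] R.square_integrable by auto
    have "expectation (\<lambda>\<omega>. clamp K (Y 1 \<omega>) + r) = expectation (\<lambda>\<omega>. Y 1 \<omega> - res K (Y 1 \<omega>) + r)"
      by (simp add: res_def)
    also have "\<dots> = expectation (Y 1)"
      using intR(1) Y_integrable[of 1] by (simp add: r_def prob_space)
    finally have "expectation (\<lambda>\<omega>. clamp K (Y 1 \<omega>) + r) < 0" using neg by simp
    then obtain C where C: "\<And>n. expectation (\<lambda>\<omega>. (A.W n \<omega>)\<^sup>2) \<le> C"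
    proof (rule A.W_square_bounded)
      show "\<bar>clamp K (Y i \<omega>) + r\<bar> \<le> real K + \<bar>r\<bar>" for i \<omega>
        using clamp_bound[of K "Y i \<omega>"] by linarith
    qed blast
    have "expectation (\<lambda>\<omega>. res K (Y 1 \<omega>) - r) = 0"
      using intR(1) by (simp add: r_def prob_space)
    then have B: "expectation (\<lambda>\<omega>. (B.W n \<omega>)\<^sup>2) \<le> real n * expectation (\<lambda>\<omega>. (res K (Y 1 \<omega>) - r)\<^sup>2)" for n
      by (intro B.W_square_le) simp
    have "expectation (\<lambda>\<omega>. (res K (Y 1 \<omega>) - r)\<^sup>2) \<le> expectation (\<lambda>\<omega>. (res K (Y 1 \<omega>))\<^sup>2)"
      using variance_eq[OF intR] by (simp add: r_def)
    then have B': "expectation (\<lambda>\<omega>. (B.W n \<omega>)\<^sup>2) \<le> real n * e" for n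
      using B[of n] K by (meson mult_left_mono of_nat_0_le_iff order_trans less_imp_le)
    have "expectation (\<lambda>\<omega>. (W n \<omega>)\<^sup>2) \<le> 2 * C + 2 * (real n * e)" for n
    proof -
      have "W n \<omega> \<le> A.W n \<omega> + B.W n \<omega>" for \<omega>
        using lindley_subadditive[of "\<lambda>i. clamp K (Y i \<omega>) + r" "\<lambda>i. res K (Y i \<omega>) - r" n]
        unfolding W_def A.W_def B.W_def by (simp add: res_def)
      then have "(W n \<omega>)\<^sup>2 \<le> (A.W n \<omega> + B.W n \<omega>)\<^sup>2" for \<omega>
        using W_nonneg by (intro power_mono) auto
      moreover have "(A.W n \<omega> + B.W n \<omega>)\<^sup>2 \<le> 2 * (A.W n \<omega>)\<^sup>2 + 2 * (B.W n \<omega>)\<^sup>2" for \<omega>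
        using sum_squares_bound[of "A.W n \<omega>" "B.W n \<omega>"] by (simp add: power2_sum)
      ultimately have "expectation (\<lambda>\<omega>. (W n \<omega>)\<^sup>2) \<le> expectation (\<lambda>\<omega>. 2 * (A.W n \<omega>)\<^sup>2 + 2 * (B.W n \<omega>)\<^sup>2)"
        using W_square_integrable A.W_square_integrable B.W_square_integrable
        by (intro integral_mono) (auto intro: order_trans)
      also have "\<dots> = 2 * expectation (\<lambda>\<omega>. (A.W n \<omega>)\<^sup>2) + 2 * expectation (\<lambda>\<omega>. (B.W n \<omega>)\<^sup>2)"
        using A.W_square_integrable B.W_square_integrable by simp
      finally show ?thesis using C[of n] B'[of n] by linarith
    qed
    then show ?thesis by blast
  qed
  show ?thesis
  proof (rule order_tendstoI)
    fix a :: real assume "a < 0"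
    then show "\<forall>\<^sub>F n in sequentially. a < expectation (\<lambda>\<omega>. (W n \<omega>)\<^sup>2) / real n"
      by (intro always_eventually allI) (auto intro!: less_le_trans[of a 0])
  next
    fix a :: real assume a: "0 < a"
    \<comment> \<open>With \<open>a / 4\<close> the linear term contributes \<open>a / 2\<close>
      after division by \<open>n\<close>, and the other half of \<open>a\<close> is left for
      \<open>2 * C / n\<close>.\<close>
    then obtain C where C: "\<And>n. expectation (\<lambda>\<omega>. (W n \<omega>)\<^sup>2) \<le> 2 * C + 2 * (real n * (a / 4))"
      using key[of "a / 4"] by auto
    have "(\<lambda>n. 2 * C / real n + a / 2) \<longlonglongrightarrow> 0 + a / 2"
      by (intro tendsto_add lim_const_over_n tendsto_const)
    then have "\<forall>\<^sub>F n in sequentially. 2 * C / real n + a / 2 < a"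
      using a by (intro order_tendstoD(2)[of _ "0 + a / 2"]) auto
    then show "\<forall>\<^sub>F n in sequentially. expectation (\<lambda>\<omega>. (W n \<omega>)\<^sup>2) / real n < a"
      using eventually_gt_at_top[of 0]
    proof eventually_elim
      case (elim n)
      have "expectation (\<lambda>\<omega>. (W n \<omega>)\<^sup>2) / real n \<le> (2 * C + 2 * (real n * (a / 4))) / real n"
        using C by (intro divide_right_mono) auto
      also have "\<dots> = 2 * C / real n + a / 2"
        using elim by (simp add: add_divide_distrib)
      finally show ?case using elim by linarith
    qed
  qed
qed

lemma expectation_sum_square:
  assumes "expectation (Y 1) = 0"
  shows "integrable M (\<lambda>\<omega>. (\<Sum>i\<in>{1..n}. Y i \<omega>)\<^sup>2)"
    and "expectation (\<lambda>\<omega>. (\<Sum>i\<in>{1..n}. Y i \<omega>)\<^sup>2) = real n * expectation (\<lambda>\<omega>. (Y 1 \<omega>)\<^sup>2)"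
proof (induction n)
  case (Suc n)
  have ind: "indep_var borel (Y (Suc n)) borel (\<lambda>\<omega>. \<Sum>i\<in>{1..n}. Y i \<omega>)"
    by (intro indep_vars_sum indep_vars_subset[OF indep]) auto
  have intS: "integrable M (\<lambda>\<omega>. \<Sum>i\<in>{1..n}. Y i \<omega>)"
    by (intro Bochner_Integration.integrable_sum Y_integrable) auto
  have intY: "integrable M (Y (Suc n))" by (rule Y_integrable) simp
  have cross: "integrable M (\<lambda>\<omega>. Y (Suc n) \<omega> * (\<Sum>i\<in>{1..n}. Y i \<omega>))"
    "expectation (\<lambda>\<omega>. Y (Suc n) \<omega> * (\<Sum>i\<in>{1..n}. Y i \<omega>)) = 0"
    using indep_var_integrable[OF ind intY intS] indep_var_lebesgue_integral[OF ind intY intS]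
      expectation_transfer(1)[of "Suc n" "\<lambda>x. x"] assms by auto
  have eq: "(\<Sum>i\<in>{1..Suc n}. Y i \<omega>)\<^sup>2 = (\<Sum>i\<in>{1..n}. Y i \<omega>)\<^sup>2 + 2 * (Y (Suc n) \<omega> * (\<Sum>i\<in>{1..n}. Y i \<omega>)) + (Y (Suc n) \<omega>)\<^sup>2" for \<omega>
    by (simp add: power2_sum algebra_simps)
  have Y2: "integrable M (\<lambda>\<omega>. (Y (Suc n) \<omega>)\<^sup>2)" by (rule Y_square_integrable) simp
  have EY2: "expectation (\<lambda>\<omega>. (Y (Suc n) \<omega>)\<^sup>2) = expectation (\<lambda>\<omega>. (Y 1 \<omega>)\<^sup>2)"
    by (rule expectation_transfer(1)) auto
  {
    case 1
    show ?case unfolding eq using Suc(1) cross(1) Y2 by simp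
  next
    case 2
    show ?case unfolding eq using Suc(1,2) cross Y2 EY2 by (simp add: algebra_simps)
  }
qed simp_all

end

section \<open>Variance of a sum with a perturbation of order o(n)\<close>

text \<open>The constants \<open>c n\<close> do not change the variance, \<open>T n\<close>
  contributes exactly \<open>n s\<close>, and \<open>X n\<close> contributes o(n). No independence
  is assumed: the covariance is o(n) because it is bounded through the two second moments.\<close>

lemma (in prob_space) variance_perturbation:
  fixes X T :: "nat \<Rightarrow> 'a \<Rightarrow> real"
  assumes X: "\<And>n. X n \<in> borel_measurable M" "\<And>n. integrable M (\<lambda>\<omega>. (X n \<omega>)\<^sup>2)"
    and small: "(\<lambda>n. expectation (\<lambda>\<omega>. (X n \<omega>)\<^sup>2) / real n) \<longlonglongrightarrow> 0"
    and T: "\<And>n. T n \<in> borel_measurable M" "\<And>n. integrable M (\<lambda>\<omega>. (T n \<omega>)\<^sup>2)"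
      "\<And>n. expectation (T n) = 0"
      "\<And>n. expectation (\<lambda>\<omega>. (T n \<omega>)\<^sup>2) = real n * s"
    and L: "\<And>n \<omega>. \<omega> \<in> space M \<Longrightarrow> L n \<omega> = X n \<omega> + T n \<omega> + c n"
  shows "(\<lambda>n. variance (L n) / real n) \<longlonglongrightarrow> s"
proof -
  have intX: "integrable M (X n)" and intT: "integrable M (T n)" for n
    using X T by (auto intro: square_integrable_imp_integrable)
  define x where "x n = variance (X n) / real n" for n
  have x_nonneg: "x n \<ge> 0" for n
    by (simp add: x_def)
  have s: "s \<ge> 0"
  proof -
    have "0 \<le> expectation (\<lambda>\<omega>. (T 1 \<omega>)\<^sup>2)" by simp
    then show ?thesis by (simp only: T(4) of_nat_1 mult_1)
  qed
  have x_le: "x n \<le> expectation (\<lambda>\<omega>. (X n \<omega>)\<^sup>2) / real n" for n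
    unfolding x_def using variance_eq[OF intX X(2)] by (intro divide_right_mono) auto
  have x0: "x \<longlonglongrightarrow> 0"
    by (rule tendsto_sandwich[OF _ _ tendsto_const small]) (use x_nonneg x_le in auto)
  \<comment> \<open>The covariance is controlled by AM-GM with weight \<delta> n, where 1 / n only keeps \<delta> n positive.\<close>
  define \<delta> where "\<delta> n = sqrt (x n + 1 / real n)" for n
  have \<delta>0: "\<delta> \<longlonglongrightarrow> 0"
  proof -
    have "(\<lambda>n. sqrt (x n + 1 / real n)) \<longlonglongrightarrow> sqrt (0 + 0)"
      by (intro tendsto_real_sqrt tendsto_add x0 lim_const_over_n)
    then show ?thesis by (simp add: \<delta>_def[abs_def])
  qed
  have bound: "\<bar>variance (L n) / real n - s\<bar> \<le> x n + \<delta> n * s + \<delta> n" if n: "n > 0" for n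
  proof -
    define Xc where "Xc \<omega> = X n \<omega> - expectation (X n)" for \<omega>
    have [measurable]: "Xc \<in> borel_measurable M" "T n \<in> borel_measurable M"
      using X(1) T(1) by (auto simp: Xc_def[abs_def])
    have intXc: "integrable M (\<lambda>\<omega>. (Xc \<omega>)\<^sup>2)"
      unfolding Xc_def power2_diff using X(2) intX by simp
    have EXc: "expectation (\<lambda>\<omega>. (Xc \<omega>)\<^sup>2) = real n * x n"
      using n by (simp add: x_def Xc_def)
    have \<delta>: "\<delta> n > 0" "(\<delta> n)\<^sup>2 = x n + 1 / real n"
      using x_nonneg[of n] n by (auto simp: \<delta>_def intro: add_nonneg_pos)
    have cs: "\<bar>2 * (Xc \<omega> * T n \<omega>)\<bar> \<le> \<delta> n * (T n \<omega>)\<^sup>2 + (Xc \<omega>)\<^sup>2 / \<delta> n" for \<omega>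
    proof -
      have "0 \<le> (\<delta> n * T n \<omega> - Xc \<omega>)\<^sup>2 / \<delta> n" "0 \<le> (\<delta> n * T n \<omega> + Xc \<omega>)\<^sup>2 / \<delta> n"
        using \<delta>(1) by auto
      moreover have "(\<delta> n * T n \<omega> - Xc \<omega>)\<^sup>2 / \<delta> n = \<delta> n * (T n \<omega>)\<^sup>2 + (Xc \<omega>)\<^sup>2 / \<delta> n - 2 * (Xc \<omega> * T n \<omega>)"
        "(\<delta> n * T n \<omega> + Xc \<omega>)\<^sup>2 / \<delta> n = \<delta> n * (T n \<omega>)\<^sup>2 + (Xc \<omega>)\<^sup>2 / \<delta> n + 2 * (Xc \<omega> * T n \<omega>)"
        using \<delta>(1) by (simp_all add: field_simps power2_eq_square)
      ultimately show ?thesis by linarith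
    qed
    have intdom: "integrable M (\<lambda>\<omega>. \<delta> n * (T n \<omega>)\<^sup>2 + (Xc \<omega>)\<^sup>2 / \<delta> n)"
      using intXc T(2)[of n] by simp
    have intcross: "integrable M (\<lambda>\<omega>. 2 * (Xc \<omega> * T n \<omega>))"
      by (rule Bochner_Integration.integrable_bound[OF intdom]) (use cs in \<open>auto intro!: AE_I2 order_trans[OF _ abs_ge_self]\<close>)
    have "\<bar>expectation (\<lambda>\<omega>. 2 * (Xc \<omega> * T n \<omega>))\<bar> \<le> expectation (\<lambda>\<omega>. \<bar>2 * (Xc \<omega> * T n \<omega>)\<bar>)"
      by (rule integral_abs_bound)
    also have "\<dots> \<le> expectation (\<lambda>\<omega>. \<delta> n * (T n \<omega>)\<^sup>2 + (Xc \<omega>)\<^sup>2 / \<delta> n)"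
      using cs by (intro integral_mono intdom integrable_abs intcross) auto
    also have "\<dots> = \<delta> n * (real n * s) + real n * x n / \<delta> n"
      using intXc T(2)[of n] by (simp add: EXc T(4))
    \<comment> \<open>The square of \<open>\<delta> n\<close> is at least \<open>x n\<close>. Both
      terms of the bound are then \<open>n\<close> times a fixed multiple of
      \<open>\<delta> n\<close>, which tends to 0.\<close>
    also have "x n / \<delta> n \<le> \<delta> n"
      using \<delta> n by (simp add: divide_le_eq power2_eq_square[symmetric])
    then have "real n * x n / \<delta> n \<le> real n * \<delta> n"
      using n by (metis mult_left_mono of_nat_0_le_iff times_divide_eq_right)
    finally have cross: "\<bar>expectation (\<lambda>\<omega>. 2 * (Xc \<omega> * T n \<omega>))\<bar> \<le> real n * (\<delta> n * s + \<delta> n)"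
      by (simp add: algebra_simps)
    have "expectation (L n) = expectation (\<lambda>\<omega>. X n \<omega> + T n \<omega> + c n)"
      by (rule Bochner_Integration.integral_cong) (auto simp: L)
    also have "\<dots> = expectation (X n) + c n"
      using intX intT by (simp add: T(3) prob_space)
    finally have "variance (L n) = expectation (\<lambda>\<omega>. (Xc \<omega>)\<^sup>2 + 2 * (Xc \<omega> * T n \<omega>) + (T n \<omega>)\<^sup>2)"
      by (intro Bochner_Integration.integral_cong) (auto simp: L Xc_def power2_eq_square algebra_simps)
    also have "\<dots> = real n * x n + expectation (\<lambda>\<omega>. 2 * (Xc \<omega> * T n \<omega>)) + real n * s"
      using intXc intcross T(2)[of n] by (simp add: EXc T(4))
    finally have "variance (L n) / real n - s = x n + expectation (\<lambda>\<omega>. 2 * (Xc \<omega> * T n \<omega>)) / real n"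
      using n by (simp add: field_simps)
    moreover have "\<bar>expectation (\<lambda>\<omega>. 2 * (Xc \<omega> * T n \<omega>)) / real n\<bar> \<le> \<delta> n * s + \<delta> n"
      using cross n by (simp add: divide_le_eq mult.commute)
    ultimately show ?thesis using x_nonneg[of n] by linarith
  qed
  have "(\<lambda>n. variance (L n) / real n - s) \<longlonglongrightarrow> 0"
  proof (rule Lim_null_comparison)
    show "\<forall>\<^sub>F n in sequentially. norm (variance (L n) / real n - s) \<le> x n + \<delta> n * s + \<delta> n"
      using eventually_gt_at_top[of 0] by eventually_elim (use bound in auto)
    have "(\<lambda>n. x n + \<delta> n * s + \<delta> n) \<longlonglongrightarrow> 0 + 0 * s + 0"
      by (intro tendsto_intros x0 \<delta>0)
    then show "(\<lambda>n. x n + \<delta> n * s + \<delta> n) \<longlonglongrightarrow> 0" by simp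
  qed
  then show ?thesis by (rule LIM_zero_cancel)
qed

subsection \<open>The perimeter of the hull of a planar walk\<close>

text \<open>Components orthogonal to \<open>dir \<alpha>\<close> cancel by symmetry about the
  centre, and the cosine integrates to 2 over the half circle. The upper endpoint is written to
  match \<open>{a..a + pi}\<close> in Cauchy's formula.\<close>

lemma has_integral_inner_dir:
  "((\<lambda>\<theta>. dir \<theta> \<bullet> x) has_integral 2 * (dir \<alpha> \<bullet> x)) {\<alpha> - pi / 2..\<alpha> - pi / 2 + pi}"
proof -
  have "((\<lambda>\<theta>. cos \<theta> * x $ 1 + sin \<theta> * x $ 2) has_integral
      (sin (\<alpha> - pi / 2 + pi) * x $ 1 + - cos (\<alpha> - pi / 2 + pi) * x $ 2) -
      (sin (\<alpha> - pi / 2) * x $ 1 + - cos (\<alpha> - pi / 2) * x $ 2)) {\<alpha> - pi / 2..\<alpha> - pi / 2 + pi}"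
    by (rule fundamental_theorem_of_calculus)
      (auto intro!: derivative_eq_intros simp flip: has_real_derivative_iff_has_vector_derivative)
  moreover have "sin (\<alpha> - pi / 2 + pi) = cos \<alpha>" "cos (\<alpha> - pi / 2 + pi) = - sin \<alpha>"
    "sin (\<alpha> - pi / 2) = - cos \<alpha>" "cos (\<alpha> - pi / 2) = sin \<alpha>"
    by (simp_all only: sin_add cos_add sin_diff cos_diff) simp_all
  ultimately show ?thesis
    by (simp add: inner_dir algebra_simps)
qed

lemma dir_measurable [measurable]: "dir \<in> borel_measurable borel"
proof -
  define p q :: "real^2" where "p = vector [1, 0]" and "q = vector [0, 1]"
  have "continuous_on UNIV (\<lambda>\<theta>::real. cos \<theta> *\<^sub>R p + sin \<theta> *\<^sub>R q)"
    by (intro continuous_intros)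
  moreover have "dir = (\<lambda>\<theta>. cos \<theta> *\<^sub>R p + sin \<theta> *\<^sub>R q)"
    by (rule ext) (simp add: dir_def p_def q_def vec_eq_iff forall_2 vector_2)
  ultimately show ?thesis by (simp only: borel_measurable_continuous_onI)
qed

text \<open>Relative to the final value, the maximum of the projected walk is the largest suffix sum
  of the negated steps; the negated minimum is their largest prefix sum. Hence one walk, with steps
  \<open>- (e \<bullet> Z i \<omega>)\<close>, accounts for both extremes.\<close>

lemma hull_width_eq:
  fixes Z :: "nat \<Rightarrow> 'a \<Rightarrow> real^2"
  shows "measure lborel ((\<bullet>) e ` (convex hull ((\<lambda>k. walk Z k \<omega>) ` {0..n})))
    = e \<bullet> walk Z n \<omega> + (lindley (\<lambda>i. - (e \<bullet> Z i \<omega>)) n + runmax (\<lambda>i. - (e \<bullet> Z i \<omega>)) n)"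
proof -
  define V where "V = (\<lambda>k. e \<bullet> walk Z k \<omega>) ` {0..n}"
  have V: "finite V" "V \<noteq> {}" by (auto simp: V_def)
  have "(\<lambda>k. \<Sum>i\<in>{k+1..n}. - (e \<bullet> Z i \<omega>)) ` {0..n} = (\<lambda>t. t + - (e \<bullet> walk Z n \<omega>)) ` V"
    unfolding V_def image_image
  proof (rule image_cong)
    fix k assume "k \<in> {0..n}"
    then have "{1..n} = {1..k} \<union> {k+1..n}" by auto
    then have "walk Z n \<omega> = walk Z k \<omega> + (\<Sum>i\<in>{k+1..n}. Z i \<omega>)"
      unfolding walk_def by (simp add: sum.union_disjoint)
    then show "(\<Sum>i\<in>{k+1..n}. - (e \<bullet> Z i \<omega>)) = e \<bullet> walk Z k \<omega> + - (e \<bullet> walk Z n \<omega>)"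
      by (simp add: inner_add_right inner_sum_right sum_negf)
  qed simp
  then have "lindley (\<lambda>i. - (e \<bullet> Z i \<omega>)) n = Max ((\<lambda>t. t + - (e \<bullet> walk Z n \<omega>)) ` V)"
    by (simp add: lindley_eq_Max)
  also have "\<dots> = Max V + - (e \<bullet> walk Z n \<omega>)"
    using V by (intro mono_Max_commute[symmetric]) (auto simp: mono_def)
  finally have 1: "Max V = e \<bullet> walk Z n \<omega> + lindley (\<lambda>i. - (e \<bullet> Z i \<omega>)) n" by simp
  have "(\<lambda>k. \<Sum>i\<in>{1..k}. - (e \<bullet> Z i \<omega>)) ` {0..n} = uminus ` V"
    unfolding V_def image_image by (intro image_cong) (auto simp: walk_def inner_sum_right sum_negf)
  then have "runmax (\<lambda>i. - (e \<bullet> Z i \<omega>)) n = Max (uminus ` V)"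
    by (simp only: runmax_def)
  then have 2: "Min V = - runmax (\<lambda>i. - (e \<bullet> Z i \<omega>)) n"
    using minus_Min_eq_Max[OF V] by simp
  have "measure lborel ((\<bullet>) e ` (convex hull ((\<lambda>k. walk Z k \<omega>) ` {0..n}))) = Max V - Min V"
    by (subst measure_inner_image_hull) (auto simp: V_def image_image)
  then show ?thesis using 1 2 by simp
qed

section \<open>Moments of the width in excess of the projected endpoint\<close>

locale planar_walk = prob_space +
  fixes Z :: "nat \<Rightarrow> 'a \<Rightarrow> real^2"
  assumes indep: "indep_vars (\<lambda>_. borel) Z {1..}"
    and ident: "\<And>i. i \<ge> 1 \<Longrightarrow> distr M borel (Z i) = distr M borel (Z 1)"
    and second_moment: "integrable M (\<lambda>\<omega>. (norm (Z 1 \<omega>))\<^sup>2)"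
begin

lemma Z_measurable [measurable]: "i \<ge> 1 \<Longrightarrow> Z i \<in> borel_measurable M"
  using indep by (auto simp: indep_vars_def)

lemma Z_integrable: "integrable M (Z 1)"
proof -
  have "integrable M (\<lambda>\<omega>. norm (Z 1 \<omega>))"
    by (rule square_integrable_imp_integrable) (use second_moment in auto)
  then show ?thesis by (subst (asm) integrable_norm_iff) auto
qed

lemma iid_affine: "iid_sequence M (\<lambda>i \<omega>. e \<bullet> Z i \<omega> + c)"
proof
  show "indep_vars (\<lambda>_. borel) (\<lambda>i \<omega>. e \<bullet> Z i \<omega> + c) {1..}"
    by (rule indep_vars_compose2[OF indep]) simp
  show "distr M borel (\<lambda>\<omega>. e \<bullet> Z i \<omega> + c) = distr M borel (\<lambda>\<omega>. e \<bullet> Z 1 \<omega> + c)" if "i \<ge> 1" for i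
  proof -
    have "distr M borel (\<lambda>\<omega>. e \<bullet> Z j \<omega> + c) = distr (distr M borel (Z j)) borel (\<lambda>x. e \<bullet> x + c)" if "j \<ge> 1" for j
      using that by (subst distr_distr) (auto simp: comp_def)
    from this[OF that] this[of 1] show ?thesis using ident[OF that] by simp
  qed
  show "integrable M (\<lambda>\<omega>. (e \<bullet> Z 1 \<omega> + c)\<^sup>2)"
  proof (rule Bochner_Integration.integrable_bound)
    show "integrable M (\<lambda>\<omega>. 2 * ((norm e)\<^sup>2 * (norm (Z 1 \<omega>))\<^sup>2) + 2 * c\<^sup>2)"
      using second_moment by simp
    have "(e \<bullet> x + c)\<^sup>2 \<le> 2 * ((norm e)\<^sup>2 * (norm x)\<^sup>2) + 2 * c\<^sup>2" for x
    proof -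
      have "(e \<bullet> x)\<^sup>2 \<le> (norm e * norm x)\<^sup>2"
        using Cauchy_Schwarz_ineq2[of e x] by (simp add: abs_le_square_iff[symmetric] abs_mult)
      moreover have "(e \<bullet> x + c)\<^sup>2 \<le> 2 * (e \<bullet> x)\<^sup>2 + 2 * c\<^sup>2"
        using sum_squares_bound[of "e \<bullet> x" c] by (simp add: power2_sum)
      ultimately show ?thesis by (simp add: power_mult_distrib)
    qed
    then show "AE \<omega> in M. norm ((e \<bullet> Z 1 \<omega> + c)\<^sup>2) \<le> norm (2 * ((norm e)\<^sup>2 * (norm (Z 1 \<omega>))\<^sup>2) + 2 * c\<^sup>2)"
      by simp
  qed simp
qed

definition excess :: "nat \<Rightarrow> real \<Rightarrow> 'a \<Rightarrow> real" where
  "excess n \<theta> \<omega> = lindley (\<lambda>i. - (dir \<theta> \<bullet> Z i \<omega>)) n + runmax (\<lambda>i. - (dir \<theta> \<bullet> Z i \<omega>)) n"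

lemma excess_nonneg: "excess n \<theta> \<omega> \<ge> 0"
  by (simp add: excess_def lindley_nonneg runmax_nonneg)

text \<open>Joint measurability in angle and outcome is needed to exchange the two integrals; the
  reversed recursive form of \<open>runmax\<close> reduces it to finitely many projected
  steps.\<close>

lemma excess_measurable [measurable]:
  "(\<lambda>(\<theta>, \<omega>). excess n \<theta> \<omega>) \<in> borel_measurable (lborel \<Otimes>\<^sub>M M)"
  "excess n \<theta> \<in> borel_measurable M"
  "\<omega> \<in> space M \<Longrightarrow> (\<lambda>\<theta>. excess n \<theta> \<omega>) \<in> borel_measurable borel"
proof -
  have m: "(\<lambda>x. dir (fst x) \<bullet> Z i (snd x)) \<in> borel_measurable (lborel \<Otimes>\<^sub>M M)" if "i \<ge> 1" for i
  proof -
    have "(\<lambda>x. Z i (snd x)) \<in> borel_measurable (lborel \<Otimes>\<^sub>M M)"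
      by (rule measurable_compose[OF measurable_snd Z_measurable[OF that]])
    moreover have "(\<lambda>x. dir (fst x)) \<in> borel_measurable (lborel \<Otimes>\<^sub>M M)"
      by measurable
    ultimately show ?thesis by (intro borel_measurable_inner)
  qed
  show *: "(\<lambda>(\<theta>, \<omega>). excess n \<theta> \<omega>) \<in> borel_measurable (lborel \<Otimes>\<^sub>M M)"
    unfolding excess_def runmax_eq_lindley_rev case_prod_unfold
    by (intro borel_measurable_add lindley_measurable borel_measurable_uminus m) auto
  have "(\<lambda>\<omega>. (\<theta>, \<omega>)) \<in> measurable M (lborel \<Otimes>\<^sub>M M)" by simp
  from measurable_compose[OF this *] show "excess n \<theta> \<in> borel_measurable M" by simp
  assume "\<omega> \<in> space M"
  then have "(\<lambda>\<theta>. (\<theta>, \<omega>)) \<in> measurable lborel (lborel \<Otimes>\<^sub>M M)" by simp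
  from measurable_compose[OF this *] show "(\<lambda>\<theta>. excess n \<theta> \<omega>) \<in> borel_measurable borel" by simp
qed

lemma excess_has_integral:
  "((\<lambda>\<theta>. excess n \<theta> \<omega>) has_integral hull_perimeter_walk Z n \<omega> - 2 * (dir \<alpha> \<bullet> walk Z n \<omega>))
    {\<alpha> - pi / 2..\<alpha> - pi / 2 + pi}"
proof -
  have "polytope (convex hull ((\<lambda>k. walk Z k \<omega>) ` {0..n}))"
    unfolding polytope_def by blast
  from has_integral_diff[OF Cauchy_perimeter_formula[OF this] has_integral_inner_dir[of "walk Z n \<omega>" \<alpha>]]
  show ?thesis
    unfolding hull_width_eq hull_perimeter_walk_def[symmetric] excess_def by simp
qed

text \<open>The 4 is 2 + 2: the square of a sum is at most twice the sum of squares, and by time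
  reversal the two summands have equal second moments. Their dependence on each other does not
  matter.\<close>

lemma expectation_excess_square:
  "integrable M (\<lambda>\<omega>. (excess n \<theta> \<omega>)\<^sup>2)"
  "expectation (\<lambda>\<omega>. (excess n \<theta> \<omega>)\<^sup>2) \<le> 4 * expectation (\<lambda>\<omega>. (lindley (\<lambda>i. - (dir \<theta> \<bullet> Z i \<omega>)) n)\<^sup>2)"
proof -
  interpret Y: iid_sequence M "\<lambda>i \<omega>. - (dir \<theta> \<bullet> Z i \<omega>)"
    using iid_affine[of "- dir \<theta>" 0] by simp
  have W: "Y.W n \<omega> = lindley (\<lambda>i. - (dir \<theta> \<bullet> Z i \<omega>)) n" for \<omega>
    by (rule Y.W_def)
  define R where "R \<omega> = runmax (\<lambda>i. - (dir \<theta> \<bullet> Z i \<omega>)) n" for \<omega>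
  have R: "integrable M (\<lambda>\<omega>. (R \<omega>)\<^sup>2)" "expectation (\<lambda>\<omega>. (R \<omega>)\<^sup>2) = expectation (\<lambda>\<omega>. (Y.W n \<omega>)\<^sup>2)"
    unfolding R_def using Y.expectation_runmax[of "\<lambda>x. x\<^sup>2" n] Y.W_square_integrable[of n] by auto
  have le: "(excess n \<theta> \<omega>)\<^sup>2 \<le> 2 * (Y.W n \<omega>)\<^sup>2 + 2 * (R \<omega>)\<^sup>2" for \<omega>
    using sum_squares_bound[of "Y.W n \<omega>" "R \<omega>"] by (simp add: excess_def W R_def power2_sum)
  have dom: "integrable M (\<lambda>\<omega>. 2 * (Y.W n \<omega>)\<^sup>2 + 2 * (R \<omega>)\<^sup>2)"
    using R(1) Y.W_square_integrable[of n] by simp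
  show int: "integrable M (\<lambda>\<omega>. (excess n \<theta> \<omega>)\<^sup>2)"
    by (rule Bochner_Integration.integrable_bound[OF dom]) (use le in \<open>auto intro!: AE_I2\<close>)
  have "expectation (\<lambda>\<omega>. (excess n \<theta> \<omega>)\<^sup>2) \<le> expectation (\<lambda>\<omega>. 2 * (Y.W n \<omega>)\<^sup>2 + 2 * (R \<omega>)\<^sup>2)"
    by (intro integral_mono int dom le)
  also have "\<dots> = 4 * expectation (\<lambda>\<omega>. (Y.W n \<omega>)\<^sup>2)"
    using R Y.W_square_integrable[of n] by simp
  finally show "expectation (\<lambda>\<omega>. (excess n \<theta> \<omega>)\<^sup>2) \<le> 4 * expectation (\<lambda>\<omega>. (lindley (\<lambda>i. - (dir \<theta> \<bullet> Z i \<omega>)) n)\<^sup>2)"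
    by (simp add: W)
qed

text \<open>The factor of \<open>n\<close> is independent of \<open>\<theta>\<close>, which supplies
  the dominating function over directions. The hypothesis includes directions orthogonal to the
  drift.\<close>

lemma expectation_excess_square_le:
  assumes "expectation (Z 1) \<bullet> dir \<theta> \<ge> 0"
  shows "expectation (\<lambda>\<omega>. (excess n \<theta> \<omega>)\<^sup>2) \<le> real n * (4 * expectation (\<lambda>\<omega>. (norm (Z 1 \<omega>))\<^sup>2))"
proof -
  interpret Y: iid_sequence M "\<lambda>i \<omega>. - (dir \<theta> \<bullet> Z i \<omega>)"
    using iid_affine[of "- dir \<theta>" 0] by simp
  have W: "expectation (\<lambda>\<omega>. (lindley (\<lambda>i. - (dir \<theta> \<bullet> Z i \<omega>)) n)\<^sup>2) \<le> real n * expectation (\<lambda>\<omega>. (- (dir \<theta> \<bullet> Z 1 \<omega>))\<^sup>2)"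
    using Y.W_square_le[of n] assms Z_integrable by (simp add: Y.W_def inner_commute)
  have "(- (dir \<theta> \<bullet> x))\<^sup>2 \<le> (norm x)\<^sup>2" for x
    using Cauchy_Schwarz_ineq2[of "dir \<theta>" x] by (simp add: abs_le_square_iff[symmetric])
  then have "expectation (\<lambda>\<omega>. (- (dir \<theta> \<bullet> Z 1 \<omega>))\<^sup>2) \<le> expectation (\<lambda>\<omega>. (norm (Z 1 \<omega>))\<^sup>2)"
    by (intro integral_mono Y.square_integrable second_moment)
  then have "real n * expectation (\<lambda>\<omega>. (- (dir \<theta> \<bullet> Z 1 \<omega>))\<^sup>2) \<le> real n * expectation (\<lambda>\<omega>. (norm (Z 1 \<omega>))\<^sup>2)"
    by (intro mult_left_mono) auto
  then show ?thesis using W expectation_excess_square(2)[of n \<theta>] by linarith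
qed

lemma expectation_excess_square_tendsto:
  assumes "expectation (Z 1) \<bullet> dir \<theta> > 0"
  shows "(\<lambda>n. expectation (\<lambda>\<omega>. (excess n \<theta> \<omega>)\<^sup>2) / real n) \<longlonglongrightarrow> 0"
proof -
  interpret Y: iid_sequence M "\<lambda>i \<omega>. - (dir \<theta> \<bullet> Z i \<omega>)"
    using iid_affine[of "- dir \<theta>" 0] by simp
  have "expectation (\<lambda>\<omega>. - (dir \<theta> \<bullet> Z 1 \<omega>)) < 0"
    using assms Z_integrable by (simp add: inner_commute)
  from tendsto_mult_right_zero[OF Y.W_square_over_n_tendsto_0[OF this], of 4]
  have lim: "(\<lambda>n. 4 * expectation (\<lambda>\<omega>. (lindley (\<lambda>i. - (dir \<theta> \<bullet> Z i \<omega>)) n)\<^sup>2) / real n) \<longlonglongrightarrow> 0"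
    by (simp add: Y.W_def)
  show ?thesis
    by (rule tendsto_sandwich[OF _ _ tendsto_const lim])
      (auto intro!: always_eventually divide_right_mono expectation_excess_square(2))
qed

text \<open>\<open>X n\<close> is the integral of \<open>excess n\<close> over an interval of length
  pi, so Cauchy-Schwarz bounds its square by pi times the integral of the squared excess. Exchanging
  the integrals leaves \<open>q n \<theta>\<close>, and \<open>q n \<theta> / n\<close> tends to 0
  by dominated convergence in \<open>\<theta>\<close>.\<close>

lemma perimeter_approximation:
  assumes \<alpha>: "expectation (Z 1) = norm (expectation (Z 1)) *\<^sub>R dir \<alpha>"
    and drift: "norm (expectation (Z 1)) \<noteq> 0"
  defines "X \<equiv> \<lambda>n \<omega>. hull_perimeter_walk Z n \<omega> - 2 * (dir \<alpha> \<bullet> walk Z n \<omega>)"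
  shows "X n \<in> borel_measurable M"
    and "integrable M (\<lambda>\<omega>. (X n \<omega>)\<^sup>2)"
    and "(\<lambda>n. expectation (\<lambda>\<omega>. (X n \<omega>)\<^sup>2) / real n) \<longlonglongrightarrow> 0"
proof -
  define I where "I = {\<alpha> - pi / 2..\<alpha> - pi / 2 + pi}"
  define q where "q n \<theta> = expectation (\<lambda>\<omega>. (excess n \<theta> \<omega>)\<^sup>2)" for n \<theta>
  interpret P: pair_sigma_finite lborel M ..
  have [measurable]: "I \<in> sets borel" by (simp add: I_def)
  have emI: "emeasure lborel I = ennreal pi" by (simp add: I_def)
  have inner_mu: "expectation (Z 1) \<bullet> dir \<theta> = norm (expectation (Z 1)) * cos (\<alpha> - \<theta>)" for \<theta>
    by (subst \<alpha>) (simp add: inner_dir_dir)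
  have q_nonneg: "q n \<theta> \<ge> 0" for n \<theta> by (simp add: q_def)
  have q_measurable [measurable]: "q n \<in> borel_measurable lborel" for n
    unfolding q_def by (rule borel_measurable_lebesgue_integral) measurable
  have q_le: "indicator I \<theta> * q n \<theta> \<le> real n * (indicator I \<theta> * (4 * expectation (\<lambda>\<omega>. (norm (Z 1 \<omega>))\<^sup>2)))" for n \<theta>
  proof (cases "\<theta> \<in> I")
    case True
    then have "cos (\<alpha> - \<theta>) \<ge> 0" by (intro cos_ge_zero) (auto simp: I_def)
    then have "expectation (Z 1) \<bullet> dir \<theta> \<ge> 0"
      unfolding inner_mu by simp
    then show ?thesis
      using True expectation_excess_square_le[of \<theta> n] by (simp add: q_def)
  qed simp
  have intw: "integrable lborel (\<lambda>\<theta>. indicator I \<theta> * (4 * expectation (\<lambda>\<omega>. (norm (Z 1 \<omega>))\<^sup>2)))"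
    by (intro integrable_mult_left integrable_real_indicator) (auto simp: emI)
  have intq: "integrable lborel (\<lambda>\<theta>. indicator I \<theta> * q n \<theta>)" for n
    by (rule Bochner_Integration.integrable_bound[OF integrable_mult_right[OF intw, of "real n"]])
      (use q_le q_nonneg in \<open>auto intro!: AE_I2 simp: abs_mult\<close>)
  have XI: "(\<integral>\<^sup>+\<theta>. ennreal (excess n \<theta> \<omega>) * indicator I \<theta> \<partial>lborel) = ennreal (X n \<omega>)" if "\<omega> \<in> space M" for n \<omega>
  proof -
    have "((\<lambda>\<theta>. if \<theta> \<in> I then excess n \<theta> \<omega> else 0) has_integral X n \<omega>) UNIV"
      unfolding has_integral_restrict_UNIV X_def I_def by (rule excess_has_integral)
    then have "((\<lambda>\<theta>. indicator I \<theta> * excess n \<theta> \<omega>) has_integral X n \<omega>) UNIV"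
      by (rule has_integral_eq[rotated]) auto
    then have "(\<integral>\<^sup>+\<theta>. ennreal (indicator I \<theta> * excess n \<theta> \<omega>) \<partial>lborel) = ennreal (X n \<omega>)"
      using that by (intro nn_integral_has_integral_lborel) (auto simp: excess_nonneg)
    then show ?thesis
      by (simp add: indicator_mult_ennreal mult.commute)
  qed
  have X_nonneg: "X n \<omega> \<ge> 0" for n \<omega>
    unfolding X_def by (rule has_integral_nonneg[OF excess_has_integral]) (rule excess_nonneg)
  \<comment> \<open>Faces of a random polygon offer no direct route to measurability; the integral
    of a jointly measurable function does.\<close>
  have "(\<lambda>\<omega>. enn2real (\<integral>\<^sup>+\<theta>. ennreal (excess n \<theta> \<omega>) * indicator I \<theta> \<partial>lborel)) \<in> borel_measurable M" for n
    by (intro borel_measurable_enn2real lborel.borel_measurable_nn_integral) measurable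
  then have X_meas [measurable]: "X n \<in> borel_measurable M" for n
    by (rule measurable_cong[THEN iffD1, rotated]) (simp add: XI X_nonneg)
  show "X n \<in> borel_measurable M" by (rule X_meas)
  have sq: "ennreal ((X n \<omega>)\<^sup>2) \<le> (\<integral>\<^sup>+\<theta>. ennreal ((excess n \<theta> \<omega>)\<^sup>2) * indicator I \<theta> \<partial>lborel) * ennreal pi"
    if \<omega>: "\<omega> \<in> space M" for n \<omega>
  proof -
    \<comment> \<open>The indicator is doubled so that the second factor in Cauchy-Schwarz is the
      constant 1 on \<open>I\<close>, with squared norm pi.\<close>
    have "ennreal ((X n \<omega>)\<^sup>2) = (\<integral>\<^sup>+\<theta>. (ennreal (excess n \<theta> \<omega>) * indicator I \<theta>) * indicator I \<theta> \<partial>lborel)\<^sup>2"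
      using XI[OF \<omega>] X_nonneg by (simp add: mult.assoc ennreal_power flip: indicator_inter_arith)
    also have "\<dots> \<le> (\<integral>\<^sup>+\<theta>. (ennreal (excess n \<theta> \<omega>) * indicator I \<theta>)\<^sup>2 \<partial>lborel) * (\<integral>\<^sup>+\<theta>. (indicator I \<theta>)\<^sup>2 \<partial>lborel)"
      using \<omega> by (intro Cauchy_Schwarz_nn_integral) auto
    also have "(\<integral>\<^sup>+\<theta>. (ennreal (excess n \<theta> \<omega>) * indicator I \<theta>)\<^sup>2 \<partial>lborel) = (\<integral>\<^sup>+\<theta>. ennreal ((excess n \<theta> \<omega>)\<^sup>2) * indicator I \<theta> \<partial>lborel)"
      by (intro nn_integral_cong) (auto simp: indicator_def ennreal_power excess_nonneg)
    also have "(\<integral>\<^sup>+\<theta>. (indicator I \<theta>)\<^sup>2 \<partial>lborel) = (\<integral>\<^sup>+\<theta>. indicator I \<theta> \<partial>lborel)"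
      by (intro nn_integral_cong) (auto simp: indicator_def)
    also have "\<dots> = ennreal pi"
      by (simp add: emI)
    finally show ?thesis .
  qed
  have main: "(\<integral>\<^sup>+\<omega>. ennreal ((X n \<omega>)\<^sup>2) \<partial>M) \<le> ennreal (pi * (\<integral>\<theta>. indicator I \<theta> * q n \<theta> \<partial>lborel))" for n
  proof -
    have "(\<integral>\<^sup>+\<omega>. ennreal ((X n \<omega>)\<^sup>2) \<partial>M) \<le> (\<integral>\<^sup>+\<omega>. (\<integral>\<^sup>+\<theta>. ennreal ((excess n \<theta> \<omega>)\<^sup>2) * indicator I \<theta> \<partial>lborel) * ennreal pi \<partial>M)"
      by (intro nn_integral_mono sq)
    also have "\<dots> = (\<integral>\<^sup>+\<omega>. (\<integral>\<^sup>+\<theta>. ennreal ((excess n \<theta> \<omega>)\<^sup>2) * indicator I \<theta> \<partial>lborel) \<partial>M) * ennreal pi"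
      by (intro nn_integral_multc) measurable
    also have "(\<integral>\<^sup>+\<omega>. (\<integral>\<^sup>+\<theta>. ennreal ((excess n \<theta> \<omega>)\<^sup>2) * indicator I \<theta> \<partial>lborel) \<partial>M)
        = (\<integral>\<^sup>+\<theta>. (\<integral>\<^sup>+\<omega>. ennreal ((excess n \<theta> \<omega>)\<^sup>2) * indicator I \<theta> \<partial>M) \<partial>lborel)"
      by (rule P.Fubini') measurable
    also have "\<dots> = (\<integral>\<^sup>+\<theta>. ennreal (indicator I \<theta> * q n \<theta>) \<partial>lborel)"
    proof (intro nn_integral_cong)
      fix \<theta> :: real
      have "(\<integral>\<^sup>+\<omega>. ennreal ((excess n \<theta> \<omega>)\<^sup>2) * indicator I \<theta> \<partial>M) = (\<integral>\<^sup>+\<omega>. ennreal ((excess n \<theta> \<omega>)\<^sup>2) \<partial>M) * indicator I \<theta>"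
        by (intro nn_integral_multc) measurable
      also have "(\<integral>\<^sup>+\<omega>. ennreal ((excess n \<theta> \<omega>)\<^sup>2) \<partial>M) = ennreal (q n \<theta>)"
        unfolding q_def by (intro nn_integral_eq_integral expectation_excess_square) auto
      finally show "(\<integral>\<^sup>+\<omega>. ennreal ((excess n \<theta> \<omega>)\<^sup>2) * indicator I \<theta> \<partial>M) = ennreal (indicator I \<theta> * q n \<theta>)"
        by (simp add: indicator_mult_ennreal mult.commute)
    qed
    also have "\<dots> = ennreal (\<integral>\<theta>. indicator I \<theta> * q n \<theta> \<partial>lborel)"
      by (intro nn_integral_eq_integral intq) (simp add: q_nonneg)
    finally show ?thesis
      unfolding ennreal_mult'[OF pi_ge_zero] by (simp only: mult.commute)
  qed
  show intX: "integrable M (\<lambda>\<omega>. (X n \<omega>)\<^sup>2)" for n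
    by (rule integrableI_bounded) (use main[of n] in \<open>auto intro: le_less_trans\<close>)
  have EX: "expectation (\<lambda>\<omega>. (X n \<omega>)\<^sup>2) \<le> pi * (\<integral>\<theta>. indicator I \<theta> * q n \<theta> \<partial>lborel)" for n
  proof -
    have "ennreal (expectation (\<lambda>\<omega>. (X n \<omega>)\<^sup>2)) \<le> ennreal (pi * (\<integral>\<theta>. indicator I \<theta> * q n \<theta> \<partial>lborel))"
      using main[of n] by (subst nn_integral_eq_integral[OF intX, symmetric]) auto
    then show ?thesis
      by (subst (asm) ennreal_le_iff) (auto intro!: mult_nonneg_nonneg Bochner_Integration.integral_nonneg q_nonneg)
  qed
  have "(\<lambda>n. \<integral>\<theta>. indicator I \<theta> * q n \<theta> / real n \<partial>lborel) \<longlonglongrightarrow> (\<integral>\<theta>. 0 \<partial>(lborel :: real measure))"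
  proof (rule integral_dominated_convergence[OF _ _ intw])
    show "AE \<theta> in lborel. norm (indicator I \<theta> * q n \<theta> / real n) \<le> indicator I \<theta> * (4 * expectation (\<lambda>\<omega>. (norm (Z 1 \<omega>))\<^sup>2))" for n
    proof (intro AE_I2)
      fix \<theta> :: real
      \<comment> \<open>For \<open>n = 0\<close> the quotient is 0, the value of division by
        zero.\<close>
      have "indicator I \<theta> * q n \<theta> / real n \<le> indicator I \<theta> * (4 * expectation (\<lambda>\<omega>. (norm (Z 1 \<omega>))\<^sup>2))"
        using q_le[of \<theta> n] by (cases "n = 0") (auto simp: divide_le_eq mult.commute)
      then show "norm (indicator I \<theta> * q n \<theta> / real n) \<le> indicator I \<theta> * (4 * expectation (\<lambda>\<omega>. (norm (Z 1 \<omega>))\<^sup>2))"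
        using q_nonneg by simp
    qed
    \<comment> \<open>At the endpoints the direction is orthogonal to the drift, and the strict
      inequality behind the o(n) estimate fails.\<close>
    have "AE \<theta> in lborel. \<theta> \<notin> {\<alpha> - pi / 2, \<alpha> - pi / 2 + pi}"
      by (intro AE_not_in finite_imp_null_set_lborel) simp
    then show "AE \<theta> in lborel. (\<lambda>n. indicator I \<theta> * q n \<theta> / real n) \<longlonglongrightarrow> 0"
    proof (rule AE_mp, intro AE_I2 impI)
      fix \<theta> assume ne: "\<theta> \<notin> {\<alpha> - pi / 2, \<alpha> - pi / 2 + pi}"
      show "(\<lambda>n. indicator I \<theta> * q n \<theta> / real n) \<longlonglongrightarrow> 0"
      proof (cases "\<theta> \<in> I")
        case True
        then have "cos (\<alpha> - \<theta>) > 0"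
          using ne by (intro cos_gt_zero_pi) (auto simp: I_def)
        then have "expectation (Z 1) \<bullet> dir \<theta> > 0"
          using drift unfolding inner_mu by simp
        then show ?thesis using expectation_excess_square_tendsto True by (simp add: q_def)
      qed simp
    qed
  qed measurable
  then have "(\<lambda>n. (\<integral>\<theta>. indicator I \<theta> * q n \<theta> \<partial>lborel) / real n) \<longlonglongrightarrow> 0" by simp
  from tendsto_mult_right_zero[OF this, of pi]
  have lim: "(\<lambda>n. pi * (\<integral>\<theta>. indicator I \<theta> * q n \<theta> \<partial>lborel) / real n) \<longlonglongrightarrow> 0" by simp
  show "(\<lambda>n. expectation (\<lambda>\<omega>. (X n \<omega>)\<^sup>2) / real n) \<longlonglongrightarrow> 0"
    by (rule tendsto_sandwich[OF _ _ tendsto_const lim])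
      (auto intro!: always_eventually divide_right_mono EX)
qed

end

theorem theorem1p1:
  fixes M :: "'a measure" and Z :: "nat \<Rightarrow> 'a \<Rightarrow> real^2"
  assumes "prob_space M"
    and indep: "prob_space.indep_vars M (\<lambda>_. borel) Z {1..}"
    and ident: "\<And>i. i \<ge> 1 \<Longrightarrow> distr M borel (Z i) = distr M borel (Z 1)"
    and second_moment: "integrable M (\<lambda>\<omega>. (norm (Z 1 \<omega>))\<^sup>2)"
    and drift: "norm (prob_space.expectation M (Z 1)) \<noteq> 0"
  shows "(\<lambda>n. prob_space.variance M (hull_perimeter_walk Z n) / real n)
           \<longlonglongrightarrow>
         4 * prob_space.expectation M
               (\<lambda>\<omega>. ((Z 1 \<omega> - prob_space.expectation M (Z 1)) \<bullet> prob_space.expectation M (Z 1))\<^sup>2)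
           / (norm (prob_space.expectation M (Z 1)))\<^sup>2
       \<and> 4 * prob_space.expectation M
               (\<lambda>\<omega>. ((Z 1 \<omega> - prob_space.expectation M (Z 1)) \<bullet> prob_space.expectation M (Z 1))\<^sup>2)
           / (norm (prob_space.expectation M (Z 1)))\<^sup>2 \<ge> 0"
proof -
  interpret prob_space M by fact
  interpret planar_walk M Z
    by unfold_locales (fact indep, fact ident, fact second_moment)
  define \<mu> where "\<mu> = expectation (Z 1)"
  obtain \<alpha> where \<alpha>: "\<mu> = norm \<mu> *\<^sub>R dir \<alpha>" by (rule polar_form)
  \<comment> \<open>Chosen to centre the steps:
    \<open>2 *\<^sub>R dir \<alpha> \<bullet> Z i \<omega> + c\<close> is twice the component of
    \<open>Z i \<omega> - \<mu>\<close> along the drift.\<close>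
  define c where "c = - (2 * (dir \<alpha> \<bullet> \<mu>))"
  interpret Y: iid_sequence M "\<lambda>i \<omega>. 2 *\<^sub>R dir \<alpha> \<bullet> Z i \<omega> + c"
    by (rule iid_affine)
  have EY: "expectation (\<lambda>\<omega>. 2 *\<^sub>R dir \<alpha> \<bullet> Z 1 \<omega> + c) = 0"
    using Z_integrable by (simp add: c_def prob_space \<mu>_def)
  define s where "s = expectation (\<lambda>\<omega>. (2 *\<^sub>R dir \<alpha> \<bullet> Z 1 \<omega> + c)\<^sup>2)"
  have s: "s = 4 * expectation (\<lambda>\<omega>. ((Z 1 \<omega> - \<mu>) \<bullet> \<mu>)\<^sup>2) / (norm \<mu>)\<^sup>2"
  proof -
    have "(2 *\<^sub>R dir \<alpha> \<bullet> z + c)\<^sup>2 = 4 / (norm \<mu>)\<^sup>2 * ((z - \<mu>) \<bullet> \<mu>)\<^sup>2" for z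
    proof -
      have "(z - \<mu>) \<bullet> \<mu> = norm \<mu> * ((z - \<mu>) \<bullet> dir \<alpha>)"
        by (subst (2) \<alpha>) simp
      moreover have "2 *\<^sub>R dir \<alpha> \<bullet> z + c = 2 * ((z - \<mu>) \<bullet> dir \<alpha>)"
        by (simp add: c_def inner_diff_left inner_commute algebra_simps)
      ultimately show ?thesis
        using drift by (simp add: power_mult_distrib \<mu>_def)
    qed
    then show ?thesis by (simp add: s_def)
  qed
  note X = perimeter_approximation[OF \<alpha>[unfolded \<mu>_def] drift]
  have "(\<lambda>n. variance (hull_perimeter_walk Z n) / real n) \<longlonglongrightarrow> s"
  proof (rule variance_perturbation[OF X])
    show "expectation (\<lambda>\<omega>. (\<Sum>i\<in>{1..n}. 2 *\<^sub>R dir \<alpha> \<bullet> Z i \<omega> + c)\<^sup>2) = real n * s" for n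
      unfolding s_def by (rule Y.expectation_sum_square(2)[OF EY])
    show "integrable M (\<lambda>\<omega>. (\<Sum>i\<in>{1..n}. 2 *\<^sub>R dir \<alpha> \<bullet> Z i \<omega> + c)\<^sup>2)" for n
      by (rule Y.expectation_sum_square(1)[OF EY])
    show "(\<lambda>\<omega>. \<Sum>i\<in>{1..n}. 2 *\<^sub>R dir \<alpha> \<bullet> Z i \<omega> + c) \<in> borel_measurable M" for n
      by (intro borel_measurable_sum) auto
    show "expectation (\<lambda>\<omega>. \<Sum>i\<in>{1..n}. 2 *\<^sub>R dir \<alpha> \<bullet> Z i \<omega> + c) = 0" for n
    proof -
      have "expectation (\<lambda>\<omega>. \<Sum>i\<in>{1..n}. 2 *\<^sub>R dir \<alpha> \<bullet> Z i \<omega> + c)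
          = (\<Sum>i\<in>{1..n}. expectation (\<lambda>\<omega>. 2 *\<^sub>R dir \<alpha> \<bullet> Z i \<omega> + c))"
        by (intro Bochner_Integration.integral_sum Y.Y_integrable) auto
      also have "\<dots> = 0"
      proof (intro sum.neutral ballI)
        fix i assume "i \<in> {1..n}"
        then have "expectation (\<lambda>\<omega>. 2 *\<^sub>R dir \<alpha> \<bullet> Z i \<omega> + c) = expectation (\<lambda>\<omega>. 2 *\<^sub>R dir \<alpha> \<bullet> Z 1 \<omega> + c)"
          by (intro Y.expectation_transfer(1)[of i "\<lambda>x. x"]) auto
        then show "expectation (\<lambda>\<omega>. 2 *\<^sub>R dir \<alpha> \<bullet> Z i \<omega> + c) = 0"
          unfolding EY .
      qed
      finally show ?thesis .
    qed
    \<comment> \<open>The last term restores the deterministic part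
      \<open>2 * n * (dir \<alpha> \<bullet> \<mu>)\<close> that was removed by centring the
      steps.\<close>
    show "hull_perimeter_walk Z n \<omega> = hull_perimeter_walk Z n \<omega> - 2 * (dir \<alpha> \<bullet> walk Z n \<omega>)
        + (\<Sum>i\<in>{1..n}. 2 *\<^sub>R dir \<alpha> \<bullet> Z i \<omega> + c) + (- (real n * c))" for n \<omega>
      by (simp add: walk_def sum.distrib inner_sum_right sum_distrib_left)
  qed
  moreover have "s \<ge> 0" by (simp add: s_def)
  ultimately show ?thesis unfolding s \<mu>_def by blast
qed

end
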